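(* Every connected normal edge-transitive bi-Cayley graph is arc-transitive, half-arc-transitive or semisymmetric. Furthermore, there are infinitely many connected normal edge-transitive bi-Cayley graphs that are arc-transitive, infinitely many that are half-arc-transitive, and infinitely many that are semisymmetric.
   Context: All groups and graphs are finite; graphs are simple and undirected. Let $H$ be a group and let $R,L,S\subseteq H$ with $|R|=|L|$, $1\notin R=R^{-1}$ and $1\notin L=L^{-1}$. The bi-Cayley graph $\mathrm{BiCay}(H,R,L,S)$ over $H$ has vertex set the disjoint union of two copies $H_0=\{h_0:h\in H\}$, $H_1=\{h_1:h\in H\}$ of $H$, and edges $\{h_0,(xh)_0\}$ ($x\in R$), $\{h_1,(yh)_1\}$ ($y\in L$), $\{h_0,(zh)_1\}$ ($z\in S$), for $h\in H$. For $g\in H$, $R(g)$ is the automorphism $h_i\mapsto(hg)_i$, and $R(H)=\{R(g):g\in H\}$. The bi-Cayley graph $\Gamma=\mathrm{BiCay}(H,R,L,S)$ is normal edge-transitive if the normaliser $N_{\mathrm{Aut}(\Gamma)}(R(H))$ is transitive on the edges of $\Gamma$. A graph $\Gamma$ is arc-transitive if $\mathrm{Aut}(\Gamma)$ is transitive on ordered pairs of adjacent vertices; half-arc-transitive if $\mathrm{Aut}(\Gamma)$ is transitive on vertices and on edges but not on arcs; semisymmetric if it has constant valency and $\mathrm{Aut}(\Gamma)$ is transitive on edges but not on vertices. "Infinitely many" means up to graph isomorphism. *)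

theory Defs
  imports
    "Graph_Theory.Graph_Theory"
    "HOL-Algebra.Group_Action"
    "HOL-Algebra.Bij"
begin

text \<open>
  As in Graph_Theory, a finite simple undirected graph is a symmetric, loop-free finite digraph
  (locale \<^locale>\<open>pair_graph\<close>): \<^term>\<open>parcs \<Gamma>\<close> is the set of ordered pairs of adjacent vertices.
\<close>

type_synonym 'v graph = "'v pair_pre_digraph"

definition edges :: "'v graph \<Rightarrow> 'v set set" where
  "edges \<Gamma> = (\<lambda>(u, v). {u, v}) ` parcs \<Gamma>"

definition Aut :: "'v graph \<Rightarrow> ('v \<Rightarrow> 'v) monoid" where
  "Aut \<Gamma> = (BijGroup (pverts \<Gamma>))
     \<lparr>carrier := {f \<in> Bij (pverts \<Gamma>).
        \<forall>u\<in>pverts \<Gamma>. \<forall>v\<in>pverts \<Gamma>. (f u, f v) \<in> parcs \<Gamma> \<longleftrightarrow> (u, v) \<in> parcs \<Gamma>}\<rparr>"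

definition transitive_on_verts :: "('v \<Rightarrow> 'v) set \<Rightarrow> 'v graph \<Rightarrow> bool" where
  "transitive_on_verts K \<Gamma> \<longleftrightarrow> (\<forall>u\<in>pverts \<Gamma>. \<forall>v\<in>pverts \<Gamma>. \<exists>f\<in>K. f u = v)"

definition transitive_on_edges :: "('v \<Rightarrow> 'v) set \<Rightarrow> 'v graph \<Rightarrow> bool" where
  "transitive_on_edges K \<Gamma> \<longleftrightarrow> (\<forall>e\<in>edges \<Gamma>. \<forall>e'\<in>edges \<Gamma>. \<exists>f\<in>K. f ` e = e')"

definition transitive_on_arcs :: "('v \<Rightarrow> 'v) set \<Rightarrow> 'v graph \<Rightarrow> bool" where
  "transitive_on_arcs K \<Gamma> \<longleftrightarrow> (\<forall>a\<in>parcs \<Gamma>. \<forall>b\<in>parcs \<Gamma>. \<exists>f\<in>K. map_prod f f a = b)"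

definition arc_transitive :: "'v graph \<Rightarrow> bool" where
  "arc_transitive \<Gamma> \<longleftrightarrow> transitive_on_arcs (carrier (Aut \<Gamma>)) \<Gamma>"

definition half_arc_transitive :: "'v graph \<Rightarrow> bool" where
  "half_arc_transitive \<Gamma> \<longleftrightarrow>
     transitive_on_verts (carrier (Aut \<Gamma>)) \<Gamma> \<and> transitive_on_edges (carrier (Aut \<Gamma>)) \<Gamma> \<and>
     \<not> transitive_on_arcs (carrier (Aut \<Gamma>)) \<Gamma>"

definition constant_valency :: "'v graph \<Rightarrow> bool" where
  "constant_valency \<Gamma> \<longleftrightarrow> (\<exists>k. \<forall>v\<in>pverts \<Gamma>. out_degree (with_proj \<Gamma>) v = k)"

definition semisymmetric :: "'v graph \<Rightarrow> bool" where
  "semisymmetric \<Gamma> \<longleftrightarrow>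
     constant_valency \<Gamma> \<and> transitive_on_edges (carrier (Aut \<Gamma>)) \<Gamma> \<and>
     \<not> transitive_on_verts (carrier (Aut \<Gamma>)) \<Gamma>"


definition bicayley_data :: "'a monoid \<Rightarrow> 'a set \<Rightarrow> 'a set \<Rightarrow> 'a set \<Rightarrow> bool" where
  "bicayley_data H R L S \<longleftrightarrow>
     group H \<and> finite (carrier H) \<and>
     R \<subseteq> carrier H \<and> L \<subseteq> carrier H \<and> S \<subseteq> carrier H \<and> card R = card L \<and>
     \<one>\<^bsub>H\<^esub> \<notin> R \<and> m_inv H ` R = R \<and> \<one>\<^bsub>H\<^esub> \<notin> L \<and> m_inv H ` L = L"

text \<open>The vertices $h_0$ and $h_1$ are \<^term>\<open>Inl h\<close> and \<^term>\<open>Inr h\<close>.\<close>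

definition BiCay :: "'a monoid \<Rightarrow> 'a set \<Rightarrow> 'a set \<Rightarrow> 'a set \<Rightarrow> ('a + 'a) graph" where
  "BiCay H R L S =
     (let A = {(Inl h, Inl (x \<otimes>\<^bsub>H\<^esub> h)) | h x. h \<in> carrier H \<and> x \<in> R}
            \<union> {(Inr h, Inr (y \<otimes>\<^bsub>H\<^esub> h)) | h y. h \<in> carrier H \<and> y \<in> L}
            \<union> {(Inl h, Inr (z \<otimes>\<^bsub>H\<^esub> h)) | h z. h \<in> carrier H \<and> z \<in> S}
      in \<lparr>pverts = carrier H <+> carrier H, parcs = A \<union> A\<inverse>\<rparr>)"

definition right_translation :: "'a monoid \<Rightarrow> 'a \<Rightarrow> ('a + 'a) \<Rightarrow> ('a + 'a)" where
  "right_translation H g =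
     (\<lambda>v \<in> carrier H <+> carrier H. map_sum (\<lambda>h. h \<otimes>\<^bsub>H\<^esub> g) (\<lambda>h. h \<otimes>\<^bsub>H\<^esub> g) v)"

definition right_translations :: "'a monoid \<Rightarrow> (('a + 'a) \<Rightarrow> ('a + 'a)) set" where
  "right_translations H = right_translation H ` carrier H"

definition normal_edge_transitive ::
    "'a monoid \<Rightarrow> 'a set \<Rightarrow> 'a set \<Rightarrow> 'a set \<Rightarrow> bool" where
  "normal_edge_transitive H R L S \<longleftrightarrow>
     transitive_on_edges (normalizer (Aut (BiCay H R L S)) (right_translations H)) (BiCay H R L S)"

text \<open>
  Since every finite group is isomorphic to one whose carrier consists of natural numbers, the
  instance \<^typ>\<open>(nat + nat) graph set\<close> of the next set meets every isomorphism class of connected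
  normal edge-transitive bi-Cayley graphs.
\<close>

definition connected_net_bicayley_graphs :: "('a + 'a) graph set" where
  "connected_net_bicayley_graphs =
     {BiCay H R L S | H R L S. bicayley_data H R L S \<and> connected (with_proj (BiCay H R L S)) \<and>
        normal_edge_transitive H R L S}"

definition iso_classes :: "'v graph set \<Rightarrow> 'v graph set set" where
  "iso_classes \<G> = \<G> // {(\<Gamma>, \<Delta>). \<Gamma> \<in> \<G> \<and> \<Delta> \<in> \<G> \<and> digraph_iso (with_proj \<Gamma>) (with_proj \<Delta>)}"


lemma pair_graph_BiCay:
  assumes "bicayley_data H R L S"
  shows "pair_graph (BiCay H R L S)"
proof -
  interpret group H using assms by (simp add: bicayley_data_def)
  have fin: "finite (carrier H <+> carrier H)"
    and sub: "R \<subseteq> carrier H" "L \<subseteq> carrier H" "S \<subseteq> carrier H"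
    and one: "\<one>\<^bsub>H\<^esub> \<notin> R" "\<one>\<^bsub>H\<^esub> \<notin> L"
    using assms by (auto simp: bicayley_data_def)
  have V: "pverts (BiCay H R L S) = carrier H <+> carrier H"
    by (simp add: BiCay_def Let_def)
  have arcs: "parcs (BiCay H R L S) \<subseteq> (carrier H <+> carrier H) \<times> (carrier H <+> carrier H)"
    using sub by (auto simp: BiCay_def Let_def)
  have loop: "(v, v) \<notin> parcs (BiCay H R L S)" for v
    using sub one by (auto simp: BiCay_def Let_def subset_iff r_cancel_one')
  show ?thesis
  proof
    show "finite (pverts (BiCay H R L S))" using V fin by simp
    show "finite (parcs (BiCay H R L S))" using arcs fin by (meson finite_SigmaI finite_subset)
    show "symmetric (with_proj (BiCay H R L S))"
      by (simp add: symmetric_def BiCay_def Let_def sym_Un_converse)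
    fix e assume e: "e \<in> parcs (BiCay H R L S)"
    show "fst e \<in> pverts (BiCay H R L S)" "snd e \<in> pverts (BiCay H R L S)"
      using e arcs V by auto
    show "fst e \<noteq> snd e" using e loop by (metis prod.collapse)
  qed
qed

lemma subgroup_Aut: "subgroup (carrier (Aut \<Gamma>)) (BijGroup (pverts \<Gamma>))"
proof -
  interpret group "BijGroup (pverts \<Gamma>)" by (rule group_BijGroup)
  show ?thesis
  proof (rule subgroupI)
    show "carrier (Aut \<Gamma>) \<subseteq> carrier (BijGroup (pverts \<Gamma>))"
      by (auto simp: Aut_def BijGroup_def)
    have "(\<lambda>v\<in>pverts \<Gamma>. v) \<in> carrier (Aut \<Gamma>)"
      by (simp add: Aut_def id_Bij)
    then show "carrier (Aut \<Gamma>) \<noteq> {}" by blast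
  next
    fix f assume f: "f \<in> carrier (Aut \<Gamma>)"
    let ?g = "\<lambda>v\<in>pverts \<Gamma>. inv_into (pverts \<Gamma>) f v"
    have fB: "f \<in> Bij (pverts \<Gamma>)" using f by (simp add: Aut_def)
    then have "?g \<in> Bij (pverts \<Gamma>)" by (rule restrict_inv_into_Bij)
    moreover have "f (?g v) = v" "?g v \<in> pverts \<Gamma>" if "v \<in> pverts \<Gamma>" for v
      using fB that by (auto simp: Bij_def bij_betw_def f_inv_into_f inv_into_into)
    moreover have "(f u, f v) \<in> parcs \<Gamma> \<longleftrightarrow> (u, v) \<in> parcs \<Gamma>"
      if "u \<in> pverts \<Gamma>" "v \<in> pverts \<Gamma>" for u v
      using f that by (simp add: Aut_def)
    ultimately have "?g \<in> carrier (Aut \<Gamma>)"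
      unfolding Aut_def by (simp del: restrict_apply) metis
    then show "inv\<^bsub>BijGroup (pverts \<Gamma>)\<^esub> f \<in> carrier (Aut \<Gamma>)"
      using fB by (simp add: inv_BijGroup)
  next
    fix f g assume fg: "f \<in> carrier (Aut \<Gamma>)" "g \<in> carrier (Aut \<Gamma>)"
    then have "f \<in> Bij (pverts \<Gamma>)" "g \<in> Bij (pverts \<Gamma>)" by (auto simp: Aut_def)
    then show "f \<otimes>\<^bsub>BijGroup (pverts \<Gamma>)\<^esub> g \<in> carrier (Aut \<Gamma>)"
      using fg Bij_imp_funcset[of g] by (simp add: Aut_def BijGroup_def compose_Bij compose_eq Pi_iff)
  qed
qed

lemma group_Aut: "group (Aut \<Gamma>)"
proof -
  have "Aut \<Gamma> = (BijGroup (pverts \<Gamma>))\<lparr>carrier := carrier (Aut \<Gamma>)\<rparr>"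
    by (simp add: Aut_def)
  then show ?thesis
    using subgroup.subgroup_is_group[OF subgroup_Aut group_BijGroup] by metis
qed

lemma right_translations_subset_Aut:
  assumes "bicayley_data H R L S"
  shows "right_translations H \<subseteq> carrier (Aut (BiCay H R L S))"
proof
  fix f assume "f \<in> right_translations H"
  then obtain g where g: "g \<in> carrier H" and f: "f = right_translation H g"
    by (auto simp: right_translations_def)
  interpret group H using assms by (simp add: bicayley_data_def)
  have sub: "R \<subseteq> carrier H" "L \<subseteq> carrier H" "S \<subseteq> carrier H"
    using assms by (auto simp: bicayley_data_def)
  let ?V = "carrier H <+> carrier H"
  let ?\<Gamma> = "BiCay H R L S"
  have V: "pverts ?\<Gamma> = ?V" by (simp add: BiCay_def Let_def)
  have bij: "bij_betw (right_translation H k) ?V ?V"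
    and cancel: "v \<in> ?V \<Longrightarrow> right_translation H (inv\<^bsub>H\<^esub> k) (right_translation H k v) = v"
    if "k \<in> carrier H" for k v
  proof -
    have c: "v \<in> ?V \<Longrightarrow> right_translation H (inv\<^bsub>H\<^esub> k) (right_translation H k v) = v"
         "v \<in> ?V \<Longrightarrow> right_translation H k (right_translation H (inv\<^bsub>H\<^esub> k) v) = v" for v
      using that by (auto simp: right_translation_def m_assoc)
    show "bij_betw (right_translation H k) ?V ?V"
      by (rule bij_betw_byWitness[where f' = "right_translation H (inv\<^bsub>H\<^esub> k)"])
        (use that c in \<open>auto simp: right_translation_def\<close>)
    show "v \<in> ?V \<Longrightarrow> right_translation H (inv\<^bsub>H\<^esub> k) (right_translation H k v) = v"
      by (rule c)
  qed
  define A where "A = {(Inl h, Inl (x \<otimes>\<^bsub>H\<^esub> h)) | h x. h \<in> carrier H \<and> x \<in> R}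
      \<union> {(Inr h, Inr (x \<otimes>\<^bsub>H\<^esub> h)) | h x. h \<in> carrier H \<and> x \<in> L}
      \<union> {(Inl h, Inr (x \<otimes>\<^bsub>H\<^esub> h)) | h x. h \<in> carrier H \<and> x \<in> S}"
  have parcs: "parcs ?\<Gamma> = A \<union> A\<inverse>"
    by (simp add: BiCay_def Let_def A_def)
  have presA: "(right_translation H k u, right_translation H k v) \<in> A" (is "(?t u, ?t v) \<in> A")
    if k: "k \<in> carrier H" and uv: "(u, v) \<in> A" for k u v
  proof -
    consider (1) h x where "u = Inl h" "v = Inl (x \<otimes>\<^bsub>H\<^esub> h)" "h \<in> carrier H" "x \<in> R"
      | (2) h x where "u = Inr h" "v = Inr (x \<otimes>\<^bsub>H\<^esub> h)" "h \<in> carrier H" "x \<in> L"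
      | (3) h x where "u = Inl h" "v = Inr (x \<otimes>\<^bsub>H\<^esub> h)" "h \<in> carrier H" "x \<in> S"
      using uv unfolding A_def by blast
    then show ?thesis
    proof cases
      case 1
      then have "x \<in> carrier H" using sub by blast
      then have "?t u = Inl (h \<otimes>\<^bsub>H\<^esub> k)" "?t v = Inl (x \<otimes>\<^bsub>H\<^esub> (h \<otimes>\<^bsub>H\<^esub> k))" "h \<otimes>\<^bsub>H\<^esub> k \<in> carrier H"
        using 1 k by (auto simp: right_translation_def m_assoc)
      then show ?thesis unfolding A_def using 1 by blast
    next
      case 2
      then have "x \<in> carrier H" using sub by blast
      then have "?t u = Inr (h \<otimes>\<^bsub>H\<^esub> k)" "?t v = Inr (x \<otimes>\<^bsub>H\<^esub> (h \<otimes>\<^bsub>H\<^esub> k))" "h \<otimes>\<^bsub>H\<^esub> k \<in> carrier H"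
        using 2 k by (auto simp: right_translation_def m_assoc)
      then show ?thesis unfolding A_def using 2 by blast
    next
      case 3
      then have "x \<in> carrier H" using sub by blast
      then have "?t u = Inl (h \<otimes>\<^bsub>H\<^esub> k)" "?t v = Inr (x \<otimes>\<^bsub>H\<^esub> (h \<otimes>\<^bsub>H\<^esub> k))" "h \<otimes>\<^bsub>H\<^esub> k \<in> carrier H"
        using 3 k by (auto simp: right_translation_def m_assoc)
      then show ?thesis unfolding A_def using 3 by blast
    qed
  qed
  have pres: "(right_translation H k u, right_translation H k v) \<in> parcs ?\<Gamma>"
    if "k \<in> carrier H" "(u, v) \<in> parcs ?\<Gamma>" for k u v
    using that presA unfolding parcs by blast
  have "(f u, f v) \<in> parcs ?\<Gamma> \<longleftrightarrow> (u, v) \<in> parcs ?\<Gamma>" if "u \<in> ?V" "v \<in> ?V" for u v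
    using that pres[of g u v] pres[of "inv\<^bsub>H\<^esub> g" "f u" "f v"] cancel[of g u] cancel[of g v] g f by auto
  moreover have "f \<in> Bij ?V"
    using bij[OF g] f by (simp add: Bij_def right_translation_def)
  ultimately show "f \<in> carrier (Aut ?\<Gamma>)"
    by (simp add: Aut_def V)
qed

lemma equiv_digraph_iso:
  assumes "\<And>\<Gamma>. \<Gamma> \<in> \<G> \<Longrightarrow> pair_graph \<Gamma>"
  shows "equiv \<G> {(\<Gamma>, \<Delta>). \<Gamma> \<in> \<G> \<and> \<Delta> \<in> \<G> \<and> digraph_iso (with_proj \<Gamma>) (with_proj \<Delta>)}"
proof -
  have wf: "wf_digraph (with_proj \<Gamma>)" if "\<Gamma> \<in> \<G>" for \<Gamma>
  proof -
    interpret pair_graph \<Gamma> using assms that .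
    show ?thesis by (rule wf_digraph)
  qed
  have refl: "digraph_iso (with_proj \<Gamma>) (with_proj \<Gamma>)" if "\<Gamma> \<in> \<G>" for \<Gamma>
    unfolding digraph_iso_def
    by (rule exI[of _ "\<lparr>iso_verts = id, iso_arcs = id, iso_head = snd, iso_tail = fst\<rparr>"])
      (use wf[OF that] in \<open>simp add: pre_digraph.digraph_isomorphism_def app_iso_def with_proj_def\<close>)
  show ?thesis
  proof (rule equivI)
    show "refl_on \<G> {(\<Gamma>, \<Delta>). \<Gamma> \<in> \<G> \<and> \<Delta> \<in> \<G> \<and> digraph_iso (with_proj \<Gamma>) (with_proj \<Delta>)}"
      using refl by (auto simp: refl_on_def)
    show "sym {(\<Gamma>, \<Delta>). \<Gamma> \<in> \<G> \<and> \<Delta> \<in> \<G> \<and> digraph_iso (with_proj \<Gamma>) (with_proj \<Delta>)}"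
      using digraph_iso_swap wf by (fastforce simp: sym_def)
    show "trans {(\<Gamma>, \<Delta>). \<Gamma> \<in> \<G> \<and> \<Delta> \<in> \<G> \<and> digraph_iso (with_proj \<Gamma>) (with_proj \<Delta>)}"
      using digraph_iso_trans by (fastforce simp: trans_def)
  qed auto
qed

end

theory Submission
  imports Defs "HOL-Combinatorics.Permutations" "HOL-Library.Numeral_Type"
begin

text \<open>
  The trichotomy is formal. The normaliser lies in the automorphism group, so a normal
  edge-transitive graph is edge-transitive, and a bi-Cayley graph is regular: every vertex has
  valency \<open>|R| + |S|\<close>, because \<open>|R| = |L|\<close>. If the automorphism group is transitive on vertices,
  the graph is arc-transitive or half-arc-transitive by definition; otherwise it is semisymmetric.

  The three infinite families come from one construction. Let a finite group \<open>H\<close> act on a set \<open>V\<close>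
  preserving a relation \<open>E\<close>, choose base points \<open>v0\<close>, \<open>w0\<close>, and put
  \<open>S = {z. (z v0, w0) \<in> E}\<close>. In \<open>BiCay H {} {} S\<close> the vertices \<open>h\<^sub>0\<close> and \<open>k\<^sub>1\<close> are adjacent iff
  \<open>(h\<inverse> v0, k\<inverse> w0) \<in> E\<close>. So the graph is the bipartite graph of \<open>E\<close> in which each vertex is replaced
  by as many independent copies as its stabiliser in \<open>H\<close> has elements. The maps \<open>h\<^sub>0 \<mapsto> (x h g)\<^sub>0\<close>, \<open>h\<^sub>1 \<mapsto> (y h g)\<^sub>1\<close>, with \<open>x\<close> fixing \<open>v0\<close> and
  \<open>y\<close> fixing \<open>w0\<close>, normalise the right translations, and so does the exchange of the two halves when
  \<open>v0 = w0\<close> and \<open>E\<close> is symmetric (\<open>lift_in_N\<close>, \<open>swap_in_N\<close>). Hence the graph is normal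
  edge-transitive as soon as \<open>H\<close> is transitive on \<open>E\<close>, or \<open>v0 = w0\<close> and \<open>E\<close> is the symmetric closure
  of a relation on which \<open>H\<close> is transitive. All that is left is to find three kinds of \<open>E\<close>, with
  \<open>H\<close> the full group of symmetries of \<open>E\<close> or of its orientation.

  \<^item> Arc-transitive: \<open>E\<close> is inequality of points in an \<open>n\<close>-set. It is symmetric, and \<open>H\<close> is transitive
    on it.

  \<^item> Semisymmetric: \<open>E\<close> is incidence between the points and the two-element subsets of an \<open>n\<close>-set,
    \<open>n \<ge> 4\<close>. Two points always lie in a common pair, whereas two pairs may be disjoint, so no
    automorphism takes one half to the other.

  \<^item> Half-arc-transitive: take vertices \<open>(i, a, b)\<close> with \<open>i \<in> \<int>/3\<close>, a point \<open>a\<close> and a pair \<open>b\<close>, and arcs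
    \<open>(i, a, b) \<rightarrow> (i + 1, a', b')\<close> whenever \<open>a' \<in> b\<close>. Independent permutations of the \<open>n\<close>-set may be
    applied to the three links, each of which relates the pairs of one level to the points of the next;
    together with the rotations of \<open>\<int>/3\<close> they act transitively on the arcs. Let \<open>E\<close> be
    the symmetric closure. Two vertices with the same \<open>i\<close> and \<open>b\<close> have the same out-neighbours; two with the same
    \<open>i\<close> and \<open>a\<close> have the same in-neighbours. In the first case the points differ and share just one of
    their \<open>n - 1\<close> pairs; in the second the pairs may share one of their two points. For \<open>n \<ge> 4\<close> the second
    overlap is relatively larger, so counting common neighbours tells in-neighbours from
    out-neighbours, and no automorphism reverses an arc.

  In each family the order of \<open>H\<close>, hence the number of vertices, is unbounded.
\<close>

section \<open>Automorphisms of a graph and the trichotomy\<close>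

lemma Inl_in_Plus_iff [simp]: "Inl x \<in> A <+> B \<longleftrightarrow> x \<in> A"
  and Inr_in_Plus_iff [simp]: "Inr y \<in> A <+> B \<longleftrightarrow> y \<in> B"
  by auto

lemma mem_edges_iff: "e \<in> edges \<Gamma> \<longleftrightarrow> (\<exists>u v. (u, v) \<in> parcs \<Gamma> \<and> e = {u, v})"
  unfolding edges_def by auto

lemma mult_Aut:
  assumes "f \<in> carrier (Aut \<Gamma>)" "g \<in> carrier (Aut \<Gamma>)"
  shows "f \<otimes>\<^bsub>Aut \<Gamma>\<^esub> g = compose (pverts \<Gamma>) f g"
  using assms by (simp add: Aut_def BijGroup_def)

lemma Aut_closed: "f \<in> carrier (Aut \<Gamma>) \<Longrightarrow> v \<in> pverts \<Gamma> \<Longrightarrow> f v \<in> pverts \<Gamma>"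
  using Bij_imp_funcset[of f "pverts \<Gamma>"] by (auto simp: Aut_def)

lemma Aut_inj: "f \<in> carrier (Aut \<Gamma>) \<Longrightarrow> inj_on f (pverts \<Gamma>)"
  by (simp add: Aut_def Bij_def bij_betw_def)

lemma Aut_arc_iff:
  "f \<in> carrier (Aut \<Gamma>) \<Longrightarrow> u \<in> pverts \<Gamma> \<Longrightarrow> v \<in> pverts \<Gamma> \<Longrightarrow>
     (f u, f v) \<in> parcs \<Gamma> \<longleftrightarrow> (u, v) \<in> parcs \<Gamma>"
  by (simp add: Aut_def)

lemma normalizer_subset: "normalizer G K \<subseteq> carrier G"
  by (auto simp: normalizer_def stabilizer_def)

lemma pverts_BiCay: "pverts (BiCay H R L S) = carrier H <+> carrier H"
  by (simp add: BiCay_def Let_def)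

text \<open>
  Conjugation by \<open>f\<close> carries the right translation by \<open>g\<close> to the one by \<open>\<beta> g\<close>; this is how membership in
  the normaliser is checked below, without computing inverses of automorphisms.
\<close>

lemma in_normalizer_right_translationsI:
  assumes data: "bicayley_data H R L S"
    and f: "f \<in> carrier (Aut (BiCay H R L S))"
    and \<beta>: "\<beta> ` carrier H = carrier H"
    and comm: "\<And>g v. g \<in> carrier H \<Longrightarrow> v \<in> carrier H <+> carrier H \<Longrightarrow>
                 f (right_translation H g v) = right_translation H (\<beta> g) (f v)"
  shows "f \<in> normalizer (Aut (BiCay H R L S)) (right_translations H)"
proof -
  let ?A = "Aut (BiCay H R L S)" and ?T = "right_translations H"
  interpret A: group ?A by (rule group_Aut)
  have T: "?T \<subseteq> carrier ?A" by (rule right_translations_subset_Aut[OF data])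
  then have RA: "right_translation H g \<in> carrier ?A" if "g \<in> carrier H" for g
    using that by (auto simp: right_translations_def)
  have conj: "f \<otimes>\<^bsub>?A\<^esub> right_translation H g \<otimes>\<^bsub>?A\<^esub> inv\<^bsub>?A\<^esub> f = right_translation H (\<beta> g)"
    if g: "g \<in> carrier H" for g
  proof -
    have bg: "\<beta> g \<in> carrier H" using g \<beta> by blast
    have "f \<otimes>\<^bsub>?A\<^esub> right_translation H g = right_translation H (\<beta> g) \<otimes>\<^bsub>?A\<^esub> f"
      unfolding mult_Aut[OF f RA[OF g]] mult_Aut[OF RA[OF bg] f]
      by (rule extensionalityI[of _ "carrier H <+> carrier H"])
        (use comm[OF g] in \<open>auto simp: compose_def pverts_BiCay\<close>)
    then show ?thesis
      using f RA[OF bg] by (simp add: A.m_assoc)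
  qed
  have "f <#\<^bsub>?A\<^esub> ?T #>\<^bsub>?A\<^esub> inv\<^bsub>?A\<^esub> f
      = (\<lambda>t. f \<otimes>\<^bsub>?A\<^esub> t \<otimes>\<^bsub>?A\<^esub> inv\<^bsub>?A\<^esub> f) ` ?T"
    by (auto simp: l_coset_def r_coset_def)
  also have "\<dots> = (\<lambda>g. right_translation H (\<beta> g)) ` carrier H"
    using conj by (simp add: right_translations_def image_image)
  also have "\<dots> = right_translation H ` (\<beta> ` carrier H)"
    by auto
  also have "\<dots> = ?T"
    by (simp add: \<beta> right_translations_def)
  finally show ?thesis
    using f T by (simp add: normalizer_def stabilizer_def)
qed

text \<open>
  The \<open>0\<close>-half of the neighbours of \<open>h\<^sub>0\<close> is \<open>R h\<close>, since \<open>R\<close> is closed under inverses, and the \<open>1\<close>-half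
  is \<open>S h\<close>; for \<open>h\<^sub>1\<close> the two halves are \<open>S\<inverse> h\<close> and \<open>L h\<close>. Both times the valency is
  \<open>|R| + |S|\<close>.
\<close>

lemma constant_valency_BiCay:
  fixes H :: "'a monoid" (structure)
  assumes data: "bicayley_data H R L S"
  shows "constant_valency (BiCay H R L S)"
proof -
  interpret group H using data by (simp add: bicayley_data_def)
  have sub: "R \<subseteq> carrier H" "L \<subseteq> carrier H" "S \<subseteq> carrier H"
    and fin: "finite (carrier H)"
    and card: "card R = card L"
    and inv: "m_inv H ` R = R" "m_inv H ` L = L"
    using data by (auto simp: bicayley_data_def)
  have finS: "finite R" "finite L" "finite S"
    using sub fin finite_subset by blast+
  have invR: "inv x \<in> R" if "x \<in> R" for x using inv that by blast
  have invL: "inv x \<in> L" if "x \<in> L" for x using inv that by blast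
  have shift: "card ((\<lambda>x. x \<otimes> h) ` X) = card X" if "X \<subseteq> carrier H" "h \<in> carrier H" for X h
    using that by (intro card_image inj_onI) (metis right_cancel subsetD)
  have shift': "card ((\<lambda>x. inv x \<otimes> h) ` X) = card X" if "X \<subseteq> carrier H" "h \<in> carrier H" for X h
    using that by (intro card_image inj_onI) (metis inv_closed inv_inv right_cancel subsetD)
  have out: "out_degree (with_proj (BiCay H R L S)) v = card ({w. (v, w) \<in> parcs (BiCay H R L S)})"
    for v
  proof -
    have "out_arcs (with_proj (BiCay H R L S)) v = Pair v ` {w. (v, w) \<in> parcs (BiCay H R L S)}"
      by (auto simp: out_arcs_def)
    then show ?thesis
      by (simp add: out_degree_def card_image inj_on_def)
  qed
  have "out_degree (with_proj (BiCay H R L S)) v = card R + card S"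
    if v: "v \<in> carrier H <+> carrier H" for v
  proof (cases v)
    case (Inl h)
    then have h: "h \<in> carrier H" using v by auto
    have "{w. (v, w) \<in> parcs (BiCay H R L S)}
        = ((\<lambda>x. x \<otimes> h) ` R) <+> ((\<lambda>z. z \<otimes> h) ` S)" (is "?l = ?r")
    proof
      show "?l \<subseteq> ?r"
      proof
        fix w assume "w \<in> ?l"
        then consider (1) x where "w = Inl (x \<otimes> h)" "x \<in> R"
          | (2) k x where "w = Inl k" "k \<in> carrier H" "x \<in> R" "h = x \<otimes> k"
          | (3) z where "w = Inr (z \<otimes> h)" "z \<in> S"
          using Inl by (auto simp: BiCay_def Let_def)
        then show "w \<in> ?r"
        proof cases
          case 2
          then have "k = inv x \<otimes> h" using sub by (auto simp: inv_solve_left)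
          then show ?thesis using 2 invR by auto
        qed auto
      qed
      show "?r \<subseteq> ?l" using Inl h by (auto simp: BiCay_def Let_def)
    qed
    moreover have "card ?r = card R + card S"
      using h sub finS by (simp add: card_Plus shift)
    ultimately show ?thesis by (simp add: out)
  next
    case (Inr h)
    then have h: "h \<in> carrier H" using v by auto
    have "{w. (v, w) \<in> parcs (BiCay H R L S)}
        = ((\<lambda>z. inv z \<otimes> h) ` S) <+> ((\<lambda>x. x \<otimes> h) ` L)" (is "?l = ?r")
    proof
      show "?l \<subseteq> ?r"
      proof
        fix w assume "w \<in> ?l"
        then consider (1) x where "w = Inr (x \<otimes> h)" "x \<in> L"
          | (2) k x where "w = Inr k" "k \<in> carrier H" "x \<in> L" "h = x \<otimes> k"
          | (3) k z where "w = Inl k" "k \<in> carrier H" "z \<in> S" "h = z \<otimes> k"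
          using Inr by (auto simp: BiCay_def Let_def)
        then show "w \<in> ?r"
        proof cases
          case 2
          then have "k = inv x \<otimes> h" using sub by (auto simp: inv_solve_left)
          then show ?thesis using 2 invL by auto
        next
          case 3
          then have "k = inv z \<otimes> h" using sub by (auto simp: inv_solve_left)
          then show ?thesis using 3 by auto
        qed auto
      qed
      show "?r \<subseteq> ?l"
      proof
        fix w assume "w \<in> ?r"
        then consider (1) x where "w = Inr (x \<otimes> h)" "x \<in> L"
          | (2) z where "w = Inl (inv z \<otimes> h)" "z \<in> S" by auto
        then show "w \<in> ?l"
        proof cases
          case 1
          then show ?thesis using Inr h by (auto simp: BiCay_def Let_def)
        next
          case 2
          then have "z \<in> carrier H" using sub by auto
          then have "h = z \<otimes> (inv z \<otimes> h)" "inv z \<otimes> h \<in> carrier H"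
            using h by (auto simp: m_assoc[symmetric])
          then show ?thesis using 2 Inr by (auto simp: BiCay_def Let_def)
        qed
      qed
    qed
    moreover have "card ?r = card R + card S"
      using h sub finS by (simp add: card_Plus shift shift' card)
    ultimately show ?thesis by (simp add: out)
  qed
  then show ?thesis
    unfolding constant_valency_def pverts_BiCay by blast
qed

lemma transitive_on_edges_mono:
  "K \<subseteq> K' \<Longrightarrow> transitive_on_edges K \<Gamma> \<Longrightarrow> transitive_on_edges K' \<Gamma>"
  unfolding transitive_on_edges_def by (meson subsetD)

lemma connected_net_trichotomy:
  assumes "\<Gamma> \<in> connected_net_bicayley_graphs"
  shows "arc_transitive \<Gamma> \<or> half_arc_transitive \<Gamma> \<or> semisymmetric \<Gamma>"
proof -
  obtain H R L S where \<Gamma>: "\<Gamma> = BiCay H R L S" and data: "bicayley_data H R L S"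
    and net: "normal_edge_transitive H R L S"
    using assms by (auto simp: connected_net_bicayley_graphs_def)
  have "transitive_on_edges (carrier (Aut \<Gamma>)) \<Gamma>"
    using net transitive_on_edges_mono[OF normalizer_subset]
    by (auto simp: normal_edge_transitive_def \<Gamma>)
  moreover have "constant_valency \<Gamma>"
    using constant_valency_BiCay[OF data] by (simp add: \<Gamma>)
  ultimately show ?thesis
    unfolding arc_transitive_def half_arc_transitive_def semisymmetric_def by blast
qed

section \<open>Isomorphism classes\<close>

lemma digraph_iso_card_verts:
  assumes "digraph_iso G K"
  shows "card (verts G) = card (verts K)"
proof -
  obtain f where f: "pre_digraph.digraph_isomorphism G f" and K: "K = app_iso f G"
    using assms unfolding digraph_iso_def by blast
  have "card (iso_verts f ` verts G) = card (verts G)"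
    by (rule card_image[OF pre_digraph.digraph_isomorphism_inj_on_verts[OF f]])
  then show ?thesis unfolding K verts_app_iso by simp
qed

text \<open>
  The number of vertices is constant on isomorphism classes, so finitely many classes would bound it.
\<close>

lemma infinite_iso_classes:
  assumes unbounded: "\<And>n. \<exists>\<Gamma>\<in>\<G>. n \<le> card (pverts \<Gamma>)"
    and graphs: "\<And>\<Gamma>. \<Gamma> \<in> \<G> \<Longrightarrow> pair_graph \<Gamma>"
  shows "infinite (iso_classes \<G>)"
proof
  assume fin: "finite (iso_classes \<G>)"
  let ?r = "{(\<Gamma>, \<Delta>). \<Gamma> \<in> \<G> \<and> \<Delta> \<in> \<G> \<and> digraph_iso (with_proj \<Gamma>) (with_proj \<Delta>)}"
  let ?c = "\<lambda>X. card (pverts (SOME \<Delta>. \<Delta> \<in> X))"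
  have eq: "equiv \<G> ?r" by (rule equiv_digraph_iso[OF graphs])
  have "card (pverts \<Gamma>) \<in> ?c ` iso_classes \<G>" if "\<Gamma> \<in> \<G>" for \<Gamma>
  proof
    show "?r `` {\<Gamma>} \<in> iso_classes \<G>"
      unfolding iso_classes_def using that by (rule quotientI)
    have "\<Gamma> \<in> ?r `` {\<Gamma>}" using eq that by (rule equiv_class_self)
    then have "(SOME \<Delta>. \<Delta> \<in> ?r `` {\<Gamma>}) \<in> ?r `` {\<Gamma>}" by (rule someI)
    then have "digraph_iso (with_proj \<Gamma>) (with_proj (SOME \<Delta>. \<Delta> \<in> ?r `` {\<Gamma>}))"
      by blast
    then show "card (pverts \<Gamma>) = ?c (?r `` {\<Gamma>})"
      using digraph_iso_card_verts by fastforce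
  qed
  then have "(\<lambda>\<Gamma>. card (pverts \<Gamma>)) ` \<G> \<subseteq> ?c ` iso_classes \<G>" by blast
  then have "finite ((\<lambda>\<Gamma>. card (pverts \<Gamma>)) ` \<G>)"
    using fin by (meson finite_imageI finite_subset)
  then obtain m where m: "\<forall>k\<in>(\<lambda>\<Gamma>. card (pverts \<Gamma>)) ` \<G>. k \<le> m"
    using finite_nat_set_iff_bounded_le by blast
  then show False
    using unbounded[of "Suc m"] by force
qed

section \<open>Bi-Cayley graphs from a group action\<close>

text \<open>
  The condition that \<open>E\<close> relates only points of the orbit of \<open>v0\<close> to points of the orbit of \<open>w0\<close> says
  that every point related by \<open>E\<close> is represented by a vertex of the bi-Cayley graph.
\<close>

locale orbital_bicayley = group_action H V act
  for H :: "'a monoid" (structure) and V :: "'v set" and act :: "'a \<Rightarrow> 'v \<Rightarrow> 'v" +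
  fixes E :: "'v rel" and v0 w0 :: 'v
  assumes finite_group: "finite (carrier H)"
    and base_in: "v0 \<in> V" "w0 \<in> V"
    and E_orbits: "(x, y) \<in> E \<Longrightarrow> (\<exists>g\<in>carrier H. x = act g v0) \<and> (\<exists>g\<in>carrier H. y = act g w0)"
    and E_invariant: "g \<in> carrier H \<Longrightarrow> (x, y) \<in> E \<Longrightarrow> (act g x, act g y) \<in> E"
begin

sublocale group H
  using group_hom by (simp add: group_hom_def)

definition S :: "'a set" where
  "S = {z \<in> carrier H. (act z v0, w0) \<in> E}"

definition \<Gamma> :: "('a + 'a) graph" where
  "\<Gamma> = BiCay H {} {} S"

text \<open>
  The point of the orbit of \<open>v\<close> represented by the group element \<open>h\<close>. The inverse turns the right
  translations of \<open>H\<close> into the given left action.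
\<close>

definition pt :: "'v \<Rightarrow> 'a \<Rightarrow> 'v" where
  "pt v h = act (inv h) v"

lemma act_closed: "g \<in> carrier H \<Longrightarrow> x \<in> V \<Longrightarrow> act g x \<in> V"
  by (rule element_image) auto

lemma act_mult: "g \<in> carrier H \<Longrightarrow> h \<in> carrier H \<Longrightarrow> x \<in> V \<Longrightarrow> act (g \<otimes> h) x = act g (act h x)"
  by (rule composition_rule)

lemma act_one: "x \<in> V \<Longrightarrow> act \<one> x = x"
  using id_eq_one by (metis restrict_apply')

lemma act_inv: "g \<in> carrier H \<Longrightarrow> x \<in> V \<Longrightarrow> act (inv g) (act g x) = x"
  by (rule orbit_sym_aux) auto

lemma act_inv': "g \<in> carrier H \<Longrightarrow> x \<in> V \<Longrightarrow> act g (act (inv g) x) = x"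
  using act_inv[of "inv g" x] by simp

lemma pt_closed: "h \<in> carrier H \<Longrightarrow> v \<in> V \<Longrightarrow> pt v h \<in> V"
  by (simp add: pt_def act_closed)

lemma E_iff:
  assumes "g \<in> carrier H" "x \<in> V" "y \<in> V"
  shows "(act g x, act g y) \<in> E \<longleftrightarrow> (x, y) \<in> E"
  using E_invariant[of g x y] E_invariant[of "inv g" "act g x" "act g y"] assms
  by (auto simp: act_inv)

text \<open>
  Left factors that fix the base point do not change the represented point, and a right factor moves
  it by the action; both kinds of multiplication therefore preserve adjacency when the right factor is
  the same in the two halves.
\<close>

lemma pt_mult:
  assumes "x \<in> carrier H" "l \<in> carrier H" "g \<in> carrier H" "v \<in> V" "act x v = v"
  shows "pt v (x \<otimes> l \<otimes> g) = act (inv g) (pt v l)"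
proof -
  have "act (inv x) v = v" using act_inv[of x v] assms by simp
  then show ?thesis
    using assms by (simp add: pt_def inv_mult_group act_mult act_closed)
qed

lemma pt_surj:
  assumes "g \<in> carrier H"
  shows "\<exists>h\<in>carrier H. pt v h = act g v"
  using assms by (intro bexI[of _ "inv g"]) (auto simp: pt_def)

lemma pverts_\<Gamma>: "pverts \<Gamma> = carrier H <+> carrier H"
  by (simp add: \<Gamma>_def pverts_BiCay)

lemma S_subset: "S \<subseteq> carrier H"
  by (auto simp: S_def)

lemma bicayley_data_S: "bicayley_data H {} {} S"
  using S_subset by (simp add: bicayley_data_def finite_group is_group)

lemma mem_S_iff:
  assumes h: "h \<in> carrier H" and k: "k \<in> carrier H"
  shows "k \<otimes> inv h \<in> S \<longleftrightarrow> (pt v0 h, pt w0 k) \<in> E"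
proof -
  have "(act (k \<otimes> inv h) v0, w0) \<in> E \<longleftrightarrow> (act k (pt v0 h), act k (pt w0 k)) \<in> E"
    using h k base_in by (simp add: act_mult act_inv' pt_def)
  also have "\<dots> \<longleftrightarrow> (pt v0 h, pt w0 k) \<in> E"
    using h k base_in by (intro E_iff) (auto simp: pt_closed)
  finally show ?thesis using h k by (simp add: S_def)
qed

text \<open>
  The graph is the pullback of \<open>E\<close> along the two maps to points: \<open>k\<^sub>1\<close> is a neighbour of \<open>h\<^sub>0\<close> iff
  \<open>k h\<inverse> \<in> S\<close>, and applying \<open>k\<inverse>\<close> to \<open>(k h\<inverse> v0, w0) \<in> E\<close> gives the condition on points.
\<close>

lemma arc_LR: "(Inl h, Inr k) \<in> parcs \<Gamma> \<longleftrightarrow> h \<in> carrier H \<and> k \<in> carrier H \<and> (pt v0 h, pt w0 k) \<in> E"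
proof -
  have "(Inl h, Inr k) \<in> parcs \<Gamma> \<longleftrightarrow> h \<in> carrier H \<and> (\<exists>z\<in>S. k = z \<otimes> h)"
    by (auto simp: \<Gamma>_def BiCay_def Let_def)
  also have "\<dots> \<longleftrightarrow> h \<in> carrier H \<and> k \<in> carrier H \<and> k \<otimes> inv h \<in> S"
  proof -
    have "k = (k \<otimes> inv h) \<otimes> h" if "h \<in> carrier H" "k \<in> carrier H"
      using that by (simp add: m_assoc)
    moreover have "(z \<otimes> h) \<otimes> inv h = z" "z \<otimes> h \<in> carrier H" if "z \<in> S" "h \<in> carrier H" for z
      using that S_subset by (auto simp: m_assoc)
    ultimately show ?thesis by metis
  qed
  finally show ?thesis using mem_S_iff by blast
qed

lemma arc_sym: "(u, v) \<in> parcs \<Gamma> \<longleftrightarrow> (v, u) \<in> parcs \<Gamma>"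
  by (auto simp: \<Gamma>_def BiCay_def Let_def)

lemma arc_RL: "(Inr k, Inl h) \<in> parcs \<Gamma> \<longleftrightarrow> h \<in> carrier H \<and> k \<in> carrier H \<and> (pt v0 h, pt w0 k) \<in> E"
  using arc_sym arc_LR by blast

lemma no_arc_within: "(Inl h, Inl k) \<notin> parcs \<Gamma>" "(Inr h, Inr k) \<notin> parcs \<Gamma>"
  by (auto simp: \<Gamma>_def BiCay_def Let_def)

lemmas arc_iff = arc_LR arc_RL no_arc_within

lemma edge_cases:
  assumes "e \<in> edges \<Gamma>"
  obtains h k where "e = {Inl h, Inr k}" "h \<in> carrier H" "k \<in> carrier H" "(pt v0 h, pt w0 k) \<in> E"
proof -
  obtain u v where uv: "(u, v) \<in> parcs \<Gamma>" "e = {u, v}" using assms by (auto simp: mem_edges_iff)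
  show thesis
    using uv that by (cases u; cases v) (auto simp: arc_iff insert_commute)
qed

abbreviation N :: "('a + 'a \<Rightarrow> 'a + 'a) set" where
  "N \<equiv> normalizer (Aut \<Gamma>) (right_translations H)"

lemma N_subset_Aut: "N \<subseteq> carrier (Aut \<Gamma>)"
  by (rule normalizer_subset)

lemma subgroup_N: "subgroup N (Aut \<Gamma>)"
  unfolding \<Gamma>_def
  by (intro group.normalizer_imp_subgroup group_Aut right_translations_subset_Aut bicayley_data_S)

lemma N_compose:
  assumes "f \<in> N" "g \<in> N"
  shows "compose (pverts \<Gamma>) f g \<in> N"
proof -
  have "f \<otimes>\<^bsub>Aut \<Gamma>\<^esub> g \<in> N" using subgroup_N assms by (rule subgroup.m_closed)
  then show ?thesis using assms N_subset_Aut by (auto simp: mult_Aut subset_iff)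
qed

lemma in_N_I:
  assumes ext: "f \<in> extensional (pverts \<Gamma>)"
    and closed: "f ` pverts \<Gamma> \<subseteq> pverts \<Gamma>"
    and inj: "inj_on f (pverts \<Gamma>)"
    and arcs: "\<And>u v. u \<in> pverts \<Gamma> \<Longrightarrow> v \<in> pverts \<Gamma> \<Longrightarrow>
                 (f u, f v) \<in> parcs \<Gamma> \<longleftrightarrow> (u, v) \<in> parcs \<Gamma>"
    and \<beta>: "\<beta> ` carrier H = carrier H"
    and comm: "\<And>g v. g \<in> carrier H \<Longrightarrow> v \<in> carrier H <+> carrier H \<Longrightarrow>
                 f (right_translation H g v) = right_translation H (\<beta> g) (f v)"
  shows "f \<in> N"
proof -
  have "finite (pverts \<Gamma>)" by (simp add: pverts_\<Gamma> finite_group)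
  then have "f ` pverts \<Gamma> = pverts \<Gamma>" using closed inj by (rule endo_inj_surj)
  then have "f \<in> carrier (Aut \<Gamma>)"
    using ext inj arcs by (simp add: Aut_def Bij_def bij_betw_def)
  then show ?thesis
    unfolding \<Gamma>_def
    by (intro in_normalizer_right_translationsI[OF bicayley_data_S _ \<beta>] comm) auto
qed

text \<open>
  If \<open>g\<close> moves the points of one pair of vertices to those of another, the normaliser moves the pairs
  themselves: the stabiliser elements \<open>x = h' g h\<inverse>\<close> and \<open>y = k' g k\<inverse>\<close>, used as left factors, correct
  the position inside the fibres in each half separately.
\<close>

lemma lift_in_N:
  assumes h: "h \<in> carrier H" "h' \<in> carrier H" and k: "k \<in> carrier H" "k' \<in> carrier H"
    and g: "g \<in> carrier H"
    and gh: "act g (pt v0 h) = pt v0 h'" and gk: "act g (pt w0 k) = pt w0 k'"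
  shows "\<exists>f\<in>N. f (Inl h) = Inl h' \<and> f (Inr k) = Inr k'"
proof -
  define x where "x = h' \<otimes> g \<otimes> inv h"
  define y where "y = k' \<otimes> g \<otimes> inv k"
  have xy: "x \<in> carrier H" "y \<in> carrier H" using h k g by (auto simp: x_def y_def)
  have stab: "act x v0 = v0" "act y w0 = w0"
  proof -
    have "act x v0 = act h' (act g (pt v0 h))" "act y w0 = act k' (act g (pt w0 k))"
      using h k g base_in by (auto simp: x_def y_def act_mult act_closed pt_def)
    then show "act x v0 = v0" "act y w0 = w0"
      using gh gk h k base_in by (auto simp: pt_def act_inv')
  qed
  define f where "f = (\<lambda>v\<in>carrier H <+> carrier H.
      map_sum (\<lambda>l. x \<otimes> l \<otimes> inv g) (\<lambda>l. y \<otimes> l \<otimes> inv g) v)"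
  have f: "f (Inl l) = Inl (x \<otimes> l \<otimes> inv g)" "f (Inr l) = Inr (y \<otimes> l \<otimes> inv g)"
    if "l \<in> carrier H" for l
    using that by (auto simp: f_def)
  have "f \<in> N"
  proof (rule in_N_I[where \<beta> = "\<lambda>a. g \<otimes> a \<otimes> inv g"])
    show "f \<in> extensional (pverts \<Gamma>)" by (simp add: f_def pverts_\<Gamma>)
    show "f ` pverts \<Gamma> \<subseteq> pverts \<Gamma>" using xy g by (auto simp: pverts_\<Gamma> f)
    show "inj_on f (pverts \<Gamma>)"
      using xy g by (auto simp: pverts_\<Gamma> inj_on_def f)
    show "(f u, f v) \<in> parcs \<Gamma> \<longleftrightarrow> (u, v) \<in> parcs \<Gamma>" if "u \<in> pverts \<Gamma>" "v \<in> pverts \<Gamma>" for u v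
    proof -
      have pres: "(pt v0 (x \<otimes> l \<otimes> inv g), pt w0 (y \<otimes> m \<otimes> inv g)) \<in> E \<longleftrightarrow> (pt v0 l, pt w0 m) \<in> E"
        if "l \<in> carrier H" "m \<in> carrier H" for l m
        using that xy g stab base_in by (simp add: pt_mult E_iff pt_closed)
      show ?thesis
        using that unfolding pverts_\<Gamma> by (elim PlusE) (simp_all add: f arc_iff pres xy g)
    qed
    show "(\<lambda>a. g \<otimes> a \<otimes> inv g) ` carrier H = carrier H"
    proof (rule endo_inj_surj[OF finite_group])
      show "(\<lambda>a. g \<otimes> a \<otimes> inv g) ` carrier H \<subseteq> carrier H" using g by auto
      show "inj_on (\<lambda>a. g \<otimes> a \<otimes> inv g) (carrier H)" using g by (auto simp: inj_on_def)
    qed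
    show "f (right_translation H a v) = right_translation H (g \<otimes> a \<otimes> inv g) (f v)"
      if a: "a \<in> carrier H" and v: "v \<in> carrier H <+> carrier H" for a v
    proof -
      have *: "z \<otimes> (l \<otimes> a) \<otimes> inv g = z \<otimes> l \<otimes> inv g \<otimes> (g \<otimes> a \<otimes> inv g)"
        if "z \<in> carrier H" "l \<in> carrier H" for z l
      proof -
        have "inv g \<otimes> (g \<otimes> (a \<otimes> inv g)) = a \<otimes> inv g"
          using g a by (simp add: m_assoc[symmetric])
        then show ?thesis using that g a by (simp add: m_assoc)
      qed
      show ?thesis
        using v a xy g by (auto simp: f right_translation_def *)
    qed
  qed
  moreover have "f (Inl h) = Inl h'" "f (Inr k) = Inr k'"
    using h k g by (auto simp: f x_def y_def m_assoc)
  ultimately show ?thesis by blast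
qed

lemma flip_iff:
  "w0 = v0 \<Longrightarrow> sym E \<Longrightarrow> (pt v0 k, pt w0 h) \<in> E \<longleftrightarrow> (pt v0 h, pt w0 k) \<in> E"
  by (metis symD)

text \<open>
  The exchange of the halves even commutes with all right translations.
\<close>

lemma swap_in_N:
  assumes "w0 = v0" and "sym E"
  shows "\<exists>f\<in>N. \<forall>h\<in>carrier H. f (Inl h) = Inr h \<and> f (Inr h) = Inl h"
proof -
  define f :: "'a + 'a \<Rightarrow> 'a + 'a"
    where "f = (\<lambda>v\<in>carrier H <+> carrier H. case_sum Inr Inl v)"
  have f: "f (Inl h) = Inr h" "f (Inr h) = Inl h" if "h \<in> carrier H" for h
    using that by (auto simp: f_def)
  have "f \<in> N"
  proof (rule in_N_I[where \<beta> = "\<lambda>a. a"])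
    show "f \<in> extensional (pverts \<Gamma>)" by (simp add: f_def pverts_\<Gamma>)
    show "f ` pverts \<Gamma> \<subseteq> pverts \<Gamma>" by (auto simp: pverts_\<Gamma> f)
    show "inj_on f (pverts \<Gamma>)" by (auto simp: pverts_\<Gamma> inj_on_def f)
    show "(f u, f v) \<in> parcs \<Gamma> \<longleftrightarrow> (u, v) \<in> parcs \<Gamma>" if "u \<in> pverts \<Gamma>" "v \<in> pverts \<Gamma>" for u v
      using that by (auto simp: pverts_\<Gamma> f arc_iff flip_iff[OF assms])
    show "f (right_translation H a v) = right_translation H a (f v)"
      if "a \<in> carrier H" "v \<in> carrier H <+> carrier H" for a v
      using that by (auto simp: f right_translation_def)
  qed simp
  then show ?thesis using f by blast
qed

definition transitive_on :: "'v rel \<Rightarrow> bool" where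
  "transitive_on D \<longleftrightarrow>
     (\<forall>(x, y)\<in>D. \<forall>(x', y')\<in>D. \<exists>g\<in>carrier H. act g x = x' \<and> act g y = y')"

lemma lift_transitive_on:
  assumes "transitive_on D"
    and "h \<in> carrier H" "h' \<in> carrier H" "k \<in> carrier H" "k' \<in> carrier H"
    and "(pt v0 h, pt w0 k) \<in> D" "(pt v0 h', pt w0 k') \<in> D"
  shows "\<exists>f\<in>N. f (Inl h) = Inl h' \<and> f (Inr k) = Inr k'"
proof -
  obtain g where "g \<in> carrier H" "act g (pt v0 h) = pt v0 h'" "act g (pt w0 k) = pt w0 k'"
    using assms(1,6,7) unfolding transitive_on_def by fastforce
  then show ?thesis using assms lift_in_N by blast
qed

lemma N_transitive_on_edges_if_transitive:
  assumes "transitive_on E"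
  shows "transitive_on_edges N \<Gamma>"
  unfolding transitive_on_edges_def
proof (intro ballI)
  fix e e' assume "e \<in> edges \<Gamma>" "e' \<in> edges \<Gamma>"
  then obtain h k h' k' where hk: "e = {Inl h, Inr k}" "h \<in> carrier H" "k \<in> carrier H"
      "(pt v0 h, pt w0 k) \<in> E"
    and hk': "e' = {Inl h', Inr k'}" "h' \<in> carrier H" "k' \<in> carrier H" "(pt v0 h', pt w0 k') \<in> E"
    by (metis edge_cases)
  then obtain f where "f \<in> N" "f (Inl h) = Inl h'" "f (Inr k) = Inr k'"
    using lift_transitive_on[OF assms] by blast
  then show "\<exists>f\<in>N. f ` e = e'" using hk hk' by auto
qed

text \<open>
  Every edge can be oriented, by exchanging the halves if necessary, so that its end in the first half
  lies at the tail of an arc of \<open>D\<close>. After that the lifting of single arcs applies.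
\<close>

lemma N_transitive_on_edges_if_orientation:
  assumes w0: "w0 = v0" and E: "E = D \<union> D\<inverse>" and D: "transitive_on D"
  shows "transitive_on_edges N \<Gamma>"
proof -
  have symE: "sym E" unfolding E by (rule sym_Un_converse)
  \<comment> \<open>Swapping the halves exchanges the edges over \<open>D\<close> with those over its converse.\<close>
  have orient: "\<exists>f\<in>N. \<exists>h k. f ` e = {Inl h, Inr k} \<and> h \<in> carrier H \<and> k \<in> carrier H \<and> (pt v0 h, pt w0 k) \<in> D"
    if "e \<in> edges \<Gamma>" for e
  proof -
    obtain h k where hk: "e = {Inl h, Inr k}" "h \<in> carrier H" "k \<in> carrier H"
      "(pt v0 h, pt w0 k) \<in> E" using \<open>e \<in> edges \<Gamma>\<close> by (metis edge_cases)
    show ?thesis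
    proof (cases "(pt v0 h, pt w0 k) \<in> D")
      case True
      then obtain f where "f \<in> N" "f (Inl h) = Inl h" "f (Inr k) = Inr k"
        using lift_transitive_on[OF D hk(2) hk(2) hk(3) hk(3)] by blast
      moreover from this have "f ` e = {Inl h, Inr k}" using hk(1) by simp
      ultimately show ?thesis using True hk(2,3) by blast
    next
      case False
      then have "(pt v0 k, pt w0 h) \<in> D" using hk E w0 by auto
      moreover obtain f where "f \<in> N" "\<forall>h\<in>carrier H. f (Inl h) = Inr h \<and> f (Inr h) = Inl h"
        using swap_in_N[OF w0 symE] by blast
      moreover from this have "f ` e = {Inl k, Inr h}" using hk(1-3) by auto
      ultimately show ?thesis using hk(2,3) by blast
    qed
  qed
  interpret A: group "Aut \<Gamma>" by (rule group_Aut)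
  have inv: "\<exists>f'\<in>N. f' ` f ` e = e" if f: "f \<in> N" and e: "e \<subseteq> pverts \<Gamma>" for f e
  proof -
    have f': "inv\<^bsub>Aut \<Gamma>\<^esub> f \<in> N" using subgroup_N f by (rule subgroup.m_inv_closed)
    have fA: "f \<in> carrier (Aut \<Gamma>)" "inv\<^bsub>Aut \<Gamma>\<^esub> f \<in> carrier (Aut \<Gamma>)"
      using f f' N_subset_Aut by auto
    have "compose (pverts \<Gamma>) (inv\<^bsub>Aut \<Gamma>\<^esub> f) f = (\<lambda>v\<in>pverts \<Gamma>. v)"
      using A.l_inv[OF fA(1)] unfolding mult_Aut[OF fA(2,1)] by (simp add: Aut_def BijGroup_def)
    then have "compose (pverts \<Gamma>) (inv\<^bsub>Aut \<Gamma>\<^esub> f) f v = v" if "v \<in> pverts \<Gamma>" for v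
      using that by simp
    then have "(inv\<^bsub>Aut \<Gamma>\<^esub> f) (f v) = v" if "v \<in> e" for v
      using that e by (simp add: compose_eq subset_iff)
    then have "(inv\<^bsub>Aut \<Gamma>\<^esub> f) ` f ` e = e" by (simp add: image_image)
    then show ?thesis using f' by blast
  qed
  have Nclosed: "f v \<in> pverts \<Gamma>" if "f \<in> N" "v \<in> pverts \<Gamma>" for f v
    by (rule Aut_closed[OF subsetD[OF N_subset_Aut that(1)] that(2)])
  show ?thesis
    unfolding transitive_on_edges_def
  proof (intro ballI)
    fix e e' assume e: "e \<in> edges \<Gamma>" and e': "e' \<in> edges \<Gamma>"
    obtain f h k where f: "f \<in> N" "f ` e = {Inl h, Inr k}" "h \<in> carrier H" "k \<in> carrier H"
      "(pt v0 h, pt w0 k) \<in> D"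
      using orient[OF e] by (elim bexE exE conjE) (rule that)
    obtain f' h' k' where f': "f' \<in> N" "f' ` e' = {Inl h', Inr k'}" "h' \<in> carrier H" "k' \<in> carrier H"
      "(pt v0 h', pt w0 k') \<in> D"
      using orient[OF e'] by (elim bexE exE conjE) (rule that)
    obtain g where g: "g \<in> N" "g (Inl h) = Inl h'" "g (Inr k) = Inr k'"
      using lift_transitive_on[OF D f(3) f'(3) f(4) f'(4) f(5) f'(5)] by blast
    have sub: "e \<subseteq> pverts \<Gamma>" "e' \<subseteq> pverts \<Gamma>"
      using e e' by (auto simp: pverts_\<Gamma> elim!: edge_cases)
    obtain f'' where f'': "f'' \<in> N" "f'' ` f' ` e' = e'"
      using inv[OF f'(1) sub(2)] by (elim bexE) (rule that)
    let ?F = "compose (pverts \<Gamma>) f'' (compose (pverts \<Gamma>) g f)"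
    have "?F ` e = f'' ` g ` f ` e"
      unfolding image_image using sub(1) by (intro image_cong) (auto simp: compose_def subset_iff Nclosed[OF f(1)])
    also have "\<dots> = e'"
      using f(2) g f'' f'(2) by simp
    finally have "?F ` e = e'" .
    moreover have "?F \<in> N" by (intro N_compose f''(1) g(1) f(1))
    ultimately show "\<exists>f\<in>N. f ` e = e'"
      by (rule bexI[where x = ?F])
  qed
qed

text \<open>
  Common neighbours of points lift to common neighbours of vertices, so any two vertices of the first
  half are at distance at most two, and each vertex of the second half has a neighbour in the first.
\<close>

lemma connected_\<Gamma>:
  assumes common: "\<And>g g'. g \<in> carrier H \<Longrightarrow> g' \<in> carrier H \<Longrightarrow>
                     \<exists>y. (act g v0, y) \<in> E \<and> (act g' v0, y) \<in> E"
  shows "connected (with_proj \<Gamma>)"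
proof -
  interpret pg: pair_graph \<Gamma>
    unfolding \<Gamma>_def by (rule pair_graph_BiCay[OF bicayley_data_S])
  note trans = pg.reachable_trans and adj = pg.reachable_adjI
  have LL: "Inl h \<rightarrow>\<^sup>*\<^bsub>with_proj \<Gamma>\<^esub> Inl h'" if h: "h \<in> carrier H" "h' \<in> carrier H" for h h'
  proof -
    obtain y where y: "(pt v0 h, y) \<in> E" "(pt v0 h', y) \<in> E"
      using common[of "inv h" "inv h'"] h by (auto simp: pt_def)
    then obtain k where "k \<in> carrier H" "pt w0 k = y"
      using E_orbits pt_surj by metis
    then have "(Inl h, Inr k) \<in> parcs \<Gamma>" "(Inr k, Inl h') \<in> parcs \<Gamma>"
      using y h by (auto simp: arc_iff)
    then show ?thesis using trans[OF adj adj] by blast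
  qed
  have nb: "\<exists>h\<in>carrier H. (Inl h, Inr k) \<in> parcs \<Gamma>" if k: "k \<in> carrier H" for k
  proof -
    obtain y where y: "(act \<one> v0, y) \<in> E" using common[of \<one> \<one>] by auto
    then obtain g where g: "g \<in> carrier H" "y = act g w0" using E_orbits by blast
    let ?m = "inv k \<otimes> inv g"
    have m: "?m \<in> carrier H" using g k by simp
    have "(act ?m (act \<one> v0), act ?m y) \<in> E" using E_invariant[OF m y] .
    moreover have "act ?m y = pt w0 k"
      using g k base_in by (simp add: act_mult act_closed act_inv pt_def)
    moreover obtain h where "h \<in> carrier H" "pt v0 h = act ?m (act \<one> v0)"
      using pt_surj[OF m] base_in by (auto simp: act_one)
    ultimately show ?thesis using k by (metis arc_LR)
  qed
  have reach: "u \<rightarrow>\<^sup>*\<^bsub>with_proj \<Gamma>\<^esub> v" if "u \<in> pverts \<Gamma>" "v \<in> pverts \<Gamma>" for u v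
  proof -
    have "\<exists>h\<in>carrier H. u \<rightarrow>\<^sup>*\<^bsub>with_proj \<Gamma>\<^esub> Inl h"
    proof (cases u)
      case (Inl h)
      then show ?thesis using that(1) LL by (auto simp: pverts_\<Gamma>)
    next
      case (Inr k)
      then have "k \<in> carrier H" using that(1) by (auto simp: pverts_\<Gamma>)
      then obtain h where "h \<in> carrier H" "(Inl h, Inr k) \<in> parcs \<Gamma>"
        using nb by blast
      then show ?thesis using Inr adj arc_sym by blast
    qed
    then obtain h where h: "h \<in> carrier H" "u \<rightarrow>\<^sup>*\<^bsub>with_proj \<Gamma>\<^esub> Inl h" by blast
    have "\<exists>h\<in>carrier H. Inl h \<rightarrow>\<^sup>*\<^bsub>with_proj \<Gamma>\<^esub> v"
    proof (cases v)
      case (Inl h)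
      then show ?thesis using that(2) LL by (auto simp: pverts_\<Gamma>)
    next
      case (Inr k)
      then have "k \<in> carrier H" using that(2) by (auto simp: pverts_\<Gamma>)
      then obtain h where "h \<in> carrier H" "(Inl h, Inr k) \<in> parcs \<Gamma>"
        using nb by blast
      then show ?thesis using Inr adj by blast
    qed
    then obtain h' where h': "h' \<in> carrier H" "Inl h' \<rightarrow>\<^sup>*\<^bsub>with_proj \<Gamma>\<^esub> v" by blast
    show ?thesis using trans[OF h(2) trans[OF LL[OF h(1) h'(1)] h'(2)]] .
  qed
  have "Inl \<one> \<in> pverts \<Gamma>" by (auto simp: pverts_\<Gamma>)
  then have "pverts \<Gamma> \<noteq> {}" by blast
  then show ?thesis
    unfolding connected_def strongly_connected_def
    using reach pg.reachable_mk_symmetricI by simp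
qed

end

section \<open>Recognising the three kinds of symmetry\<close>

definition common_neighbours :: "'v graph \<Rightarrow> 'v \<Rightarrow> 'v \<Rightarrow> 'v set" where
  "common_neighbours \<Gamma> u v = {w \<in> pverts \<Gamma>. (u, w) \<in> parcs \<Gamma> \<and> (v, w) \<in> parcs \<Gamma>}"

lemma card_common_neighbours_le:
  assumes fin: "finite (pverts \<Gamma>)" and f: "f \<in> carrier (Aut \<Gamma>)"
    and uv: "u \<in> pverts \<Gamma>" "v \<in> pverts \<Gamma>"
  shows "card (common_neighbours \<Gamma> u v) \<le> card (common_neighbours \<Gamma> (f u) (f v))"
proof (rule card_inj_on_le[of f])
  show "inj_on f (common_neighbours \<Gamma> u v)"
    using Aut_inj[OF f] by (rule inj_on_subset) (auto simp: common_neighbours_def)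
  show "f ` common_neighbours \<Gamma> u v \<subseteq> common_neighbours \<Gamma> (f u) (f v)"
    using uv by (auto simp: common_neighbours_def Aut_closed[OF f] Aut_arc_iff[OF f])
  show "finite (common_neighbours \<Gamma> (f u) (f v))"
    using fin by (simp add: common_neighbours_def)
qed

context orbital_bicayley
begin

lemma finite_pverts: "finite (pverts \<Gamma>)"
  by (simp add: pverts_\<Gamma> finite_group)

lemma card_pverts: "card (pverts \<Gamma>) = 2 * card (carrier H)"
  by (simp add: pverts_\<Gamma> card_Plus finite_group)

lemma connected_net_if:
  assumes "transitive_on_edges N \<Gamma>"
    and "\<And>g g'. g \<in> carrier H \<Longrightarrow> g' \<in> carrier H \<Longrightarrow>
           \<exists>y. (act g v0, y) \<in> E \<and> (act g' v0, y) \<in> E"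
  shows "\<Gamma> \<in> connected_net_bicayley_graphs"
proof -
  have "connected (with_proj \<Gamma>)" using assms(2) by (rule connected_\<Gamma>)
  moreover have "normal_edge_transitive H {} {} S"
    using assms(1) by (simp add: normal_edge_transitive_def \<Gamma>_def)
  ultimately show ?thesis
    unfolding connected_net_bicayley_graphs_def \<Gamma>_def using bicayley_data_S by blast
qed

lemma edge_transitive_if_N: "transitive_on_edges N \<Gamma> \<Longrightarrow> transitive_on_edges (carrier (Aut \<Gamma>)) \<Gamma>"
  by (rule transitive_on_edges_mono[OF N_subset_Aut])

lemma constant_valency_\<Gamma>: "constant_valency \<Gamma>"
  unfolding \<Gamma>_def by (rule constant_valency_BiCay[OF bicayley_data_S])

text \<open>
  Arcs from the first half to the second lift from arcs of \<open>E\<close>; the exchange of the halves, before or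
  after, takes care of the arcs in the other direction.
\<close>

lemma arc_transitive_if:
  assumes w0: "w0 = v0" and sym: "sym E" and trans: "transitive_on E"
  shows "arc_transitive \<Gamma>"
proof -
  obtain s where s: "s \<in> N" "\<forall>h\<in>carrier H. s (Inl h) = Inr h \<and> s (Inr h) = Inl h"
    using swap_in_N[OF w0 sym] by blast
  have LR: "\<exists>f\<in>N. map_prod f f (Inl h, Inr k) = b"
    if a: "(Inl h, Inr k) \<in> parcs \<Gamma>" and b: "b \<in> parcs \<Gamma>" for h k b
  proof -
    have hk: "h \<in> carrier H" "k \<in> carrier H" "(pt v0 h, pt w0 k) \<in> E"
      using a by (auto simp: arc_iff)
    obtain u v where uv: "b = (u, v)" by (cases b)
    consider (1) h' k' where "u = Inl h'" "v = Inr k'" | (2) h' k' where "u = Inr h'" "v = Inl k'"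
      using b uv by (cases u; cases v) (auto simp: arc_iff)
    then show ?thesis
    proof cases
      case 1
      then have hk': "h' \<in> carrier H" "k' \<in> carrier H" "(pt v0 h', pt w0 k') \<in> E"
        using b uv by (auto simp: arc_iff)
      obtain f where "f \<in> N" "f (Inl h) = Inl h'" "f (Inr k) = Inr k'"
        using lift_transitive_on[OF trans hk(1) hk'(1) hk(2) hk'(2) hk(3) hk'(3)] by blast
      then show ?thesis using uv 1 by (intro bexI[of _ f]) auto
    next
      case 2
      then have hk': "h' \<in> carrier H" "k' \<in> carrier H" "(pt v0 h', pt w0 k') \<in> E"
        using b uv flip_iff[OF w0 sym] by (auto simp: arc_iff)
      obtain f where f: "f \<in> N" "f (Inl h) = Inl h'" "f (Inr k) = Inr k'"
        using lift_transitive_on[OF trans hk(1) hk'(1) hk(2) hk'(2) hk(3) hk'(3)] by blast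
      let ?F = "compose (pverts \<Gamma>) s f"
      have "map_prod ?F ?F (Inl h, Inr k) = b"
        using hk hk' uv 2 f s by (simp add: compose_def pverts_\<Gamma>)
      moreover have "?F \<in> N" using s(1) f(1) by (rule N_compose)
      ultimately show ?thesis by (rule bexI[where x = ?F])
    qed
  qed
  have "\<exists>f\<in>N. map_prod f f a = b" if a: "a \<in> parcs \<Gamma>" and b: "b \<in> parcs \<Gamma>" for a b
  proof -
    obtain u v where uv: "a = (u, v)" by (cases a)
    consider (1) h k where "u = Inl h" "v = Inr k" | (2) h k where "u = Inr h" "v = Inl k"
      using a uv by (cases u; cases v) (auto simp: arc_iff)
    then show ?thesis
    proof cases
      case 1
      then show ?thesis using LR a b uv by simp
    next
      case 2
      then have hk: "h \<in> carrier H" "k \<in> carrier H" "(Inl h, Inr k) \<in> parcs \<Gamma>"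
        using a uv flip_iff[OF w0 sym] by (auto simp: arc_iff)
      obtain f where f: "f \<in> N" "map_prod f f (Inl h, Inr k) = b"
        using LR[OF hk(3) b] by (elim bexE) (rule that)
      let ?F = "compose (pverts \<Gamma>) f s"
      have "map_prod ?F ?F a = b"
        using hk uv 2 f s by (auto simp: compose_def pverts_\<Gamma>)
      moreover have "?F \<in> N" using f(1) s(1) by (rule N_compose)
      ultimately show ?thesis by (rule bexI[where x = ?F])
    qed
  qed
  then show ?thesis
    unfolding arc_transitive_def transitive_on_arcs_def using N_subset_Aut by (meson subsetD)
qed

text \<open>
  Call two vertices near if they have a common neighbour. All vertices of the first half are near each
  other, but in the second half some are not; so the number of vertices near a given one separates
  the halves.
\<close>

lemma semisymmetric_if:
  assumes trans: "transitive_on E"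
    and common: "\<And>g g'. g \<in> carrier H \<Longrightarrow> g' \<in> carrier H \<Longrightarrow>
                   \<exists>y. (act g v0, y) \<in> E \<and> (act g' v0, y) \<in> E"
    and disjoint: "g \<in> carrier H" "\<And>x. \<not> ((x, w0) \<in> E \<and> (x, act g w0) \<in> E)"
  shows "semisymmetric \<Gamma>"
proof -
  define near where "near u = {u' \<in> pverts \<Gamma>. common_neighbours \<Gamma> u u' \<noteq> {}}" for u
  have "\<not> transitive_on_verts (carrier (Aut \<Gamma>)) \<Gamma>"
  proof
    assume "transitive_on_verts (carrier (Aut \<Gamma>)) \<Gamma>"
    then obtain f where f: "f \<in> carrier (Aut \<Gamma>)" and f1: "f (Inl \<one>) = Inr \<one>"
      unfolding transitive_on_verts_def by (metis InlI InrI one_closed pverts_\<Gamma>)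
    have Inl_near: "Inl h \<in> near (Inl \<one>)" if h: "h \<in> carrier H" for h
    proof -
      obtain y where y: "(pt v0 \<one>, y) \<in> E" "(pt v0 h, y) \<in> E"
        using common[of "inv \<one>" "inv h"] h by (auto simp: pt_def)
      moreover obtain k where "k \<in> carrier H" "pt w0 k = y"
        using E_orbits[OF y(1)] pt_surj by metis
      ultimately have "Inr k \<in> common_neighbours \<Gamma> (Inl \<one>) (Inl h)"
        using h by (auto simp: common_neighbours_def arc_iff pverts_\<Gamma>)
      then show ?thesis using h by (auto simp: near_def pverts_\<Gamma>)
    qed
    have Inr_near: "near (Inr \<one>) \<subseteq> Inr ` (carrier H - {inv g})"
    proof
      fix u assume "u \<in> near (Inr \<one>)"
      then obtain w where w: "u \<in> pverts \<Gamma>" "(Inr \<one>, w) \<in> parcs \<Gamma>" "(u, w) \<in> parcs \<Gamma>"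
        by (auto simp: near_def common_neighbours_def)
      then obtain h k where hk: "w = Inl h" "u = Inr k" "k \<in> carrier H"
          "(pt v0 h, pt w0 \<one>) \<in> E" "(pt v0 h, pt w0 k) \<in> E"
        by (cases w; cases u) (auto simp: arc_iff)
      have "k \<noteq> inv g"
        using disjoint hk(4,5) base_in by (auto simp: pt_def act_one)
      then show "u \<in> Inr ` (carrier H - {inv g})" using hk by blast
    qed
    have "card (carrier H) = card (Inl ` carrier H :: ('a + 'a) set)"
      by (simp add: card_image)
    also have "\<dots> \<le> card (near (Inl \<one>))"
      using Inl_near finite_pverts by (intro card_mono) (auto simp: near_def)
    also have "\<dots> \<le> card (near (f (Inl \<one>)))"
    proof (rule card_inj_on_le[of f])
      show "inj_on f (near (Inl \<one>))"
        using Aut_inj[OF f] by (rule inj_on_subset) (auto simp: near_def)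
      show "finite (near (f (Inl \<one>)))" using finite_pverts by (simp add: near_def)
      show "f ` near (Inl \<one>) \<subseteq> near (f (Inl \<one>))"
      proof clarify
        fix u assume "u \<in> near (Inl \<one>)"
        then obtain w where w: "u \<in> pverts \<Gamma>" "w \<in> pverts \<Gamma>" "(Inl \<one>, w) \<in> parcs \<Gamma>" "(u, w) \<in> parcs \<Gamma>"
          by (auto simp: near_def common_neighbours_def)
        have "Inl \<one> \<in> pverts \<Gamma>" by (auto simp: pverts_\<Gamma>)
        then have "f w \<in> common_neighbours \<Gamma> (f (Inl \<one>)) (f u)"
          using w by (auto simp: common_neighbours_def Aut_closed[OF f] Aut_arc_iff[OF f])
        then show "f u \<in> near (f (Inl \<one>))"
          using w(1) by (auto simp: near_def Aut_closed[OF f])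
      qed
    qed
    also have "\<dots> \<le> card (Inr ` (carrier H - {inv g}) :: ('a + 'a) set)"
      unfolding f1 using Inr_near finite_group by (intro card_mono) auto
    also have "\<dots> = card (carrier H - {inv g})"
      by (simp add: card_image)
    also have "\<dots> < card (carrier H)"
      using disjoint(1) finite_group by (intro psubset_card_mono) auto
    finally show False by simp
  qed
  then show ?thesis
    unfolding semisymmetric_def
    using constant_valency_\<Gamma> edge_transitive_if_N[OF N_transitive_on_edges_if_transitive[OF trans]]
    by blast
qed

text \<open>
  The group is transitive on the orbit of \<open>w0\<close>, so all points of it have equally many representatives,
  and cardinalities computed with points have to be multiplied by this number.
\<close>

lemma card_fibre:
  assumes "g \<in> carrier H"
  shows "card {k \<in> carrier H. pt w0 k = act g w0} = card {k \<in> carrier H. pt w0 k = w0}"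
proof (rule bij_betw_same_card[of "\<lambda>k. k \<otimes> g"],
    rule bij_betw_byWitness[where f' = "\<lambda>k. k \<otimes> inv g"])
  show "(\<lambda>k. k \<otimes> g) ` {k \<in> carrier H. pt w0 k = act g w0} \<subseteq> {k \<in> carrier H. pt w0 k = w0}"
    using assms base_in by (auto simp: pt_def inv_mult_group act_mult act_inv)
  show "(\<lambda>k. k \<otimes> inv g) ` {k \<in> carrier H. pt w0 k = w0} \<subseteq> {k \<in> carrier H. pt w0 k = act g w0}"
    using assms base_in by (auto simp: pt_def inv_mult_group act_mult act_inv)
qed (use assms in \<open>auto simp: m_assoc\<close>)

lemma card_preimage:
  assumes "W \<subseteq> (\<lambda>g. act g w0) ` carrier H"
  shows "card {k \<in> carrier H. pt w0 k \<in> W} = card W * card {k \<in> carrier H. pt w0 k = w0}"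
proof -
  have finW: "finite W" using assms finite_group finite_subset by blast
  have "{k \<in> carrier H. pt w0 k \<in> W} = (\<Union>x\<in>W. {k \<in> carrier H. pt w0 k = x})" by auto
  also have "card \<dots> = (\<Sum>x\<in>W. card {k \<in> carrier H. pt w0 k = x})"
    using finW finite_group by (intro card_UN_disjoint) auto
  also have "\<dots> = (\<Sum>x\<in>W. card {k \<in> carrier H. pt w0 k = w0})"
    using assms by (intro sum.cong) (auto simp: card_fibre)
  finally show ?thesis by simp
qed

lemma card_common_neighbours:
  assumes "h \<in> carrier H" "h' \<in> carrier H"
  shows "card (common_neighbours \<Gamma> (Inl h) (Inl h'))
       = card {y. (pt v0 h, y) \<in> E \<and> (pt v0 h', y) \<in> E} * card {k \<in> carrier H. pt w0 k = w0}"
proof -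
  let ?W = "{y. (pt v0 h, y) \<in> E \<and> (pt v0 h', y) \<in> E}"
  have "common_neighbours \<Gamma> (Inl h) (Inl h') = Inr ` {k \<in> carrier H. pt w0 k \<in> ?W}"
  proof (intro equalityI subsetI)
    fix w assume "w \<in> common_neighbours \<Gamma> (Inl h) (Inl h')"
    then show "w \<in> Inr ` {k \<in> carrier H. pt w0 k \<in> ?W}"
      by (cases w) (auto simp: common_neighbours_def arc_iff)
  qed (use assms in \<open>auto simp: common_neighbours_def arc_iff pverts_\<Gamma>\<close>)
  moreover have "card {k \<in> carrier H. pt w0 k \<in> ?W} = card ?W * card {k \<in> carrier H. pt w0 k = w0}"
    by (rule card_preimage) (use E_orbits in blast)
  ultimately show ?thesis by (simp only: card_image[OF inj_Inr])
qed

text \<open>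
  The right translations are transitive on each half.
\<close>

lemma vertex_transitive_if:
  assumes w0: "w0 = v0" and sym: "sym E"
  shows "transitive_on_verts (carrier (Aut \<Gamma>)) \<Gamma>"
proof -
  obtain s where s: "s \<in> N" "\<forall>h\<in>carrier H. s (Inl h) = Inr h \<and> s (Inr h) = Inl h"
    using swap_in_N[OF w0 sym] by blast
  have move: "\<exists>f\<in>N. f (Inl h) = Inl h' \<and> f (Inr h) = Inr h'"
    if "h \<in> carrier H" "h' \<in> carrier H" for h h'
  proof (rule lift_in_N[where g = "inv h' \<otimes> h"])
    show "act (inv h' \<otimes> h) (pt v0 h) = pt v0 h'" "act (inv h' \<otimes> h) (pt w0 h) = pt w0 h'"
      using that base_in by (auto simp: pt_def act_mult act_closed act_inv')
  qed (use that in auto)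
  have "\<exists>f\<in>N. f u = v" if uv: "u \<in> pverts \<Gamma>" "v \<in> pverts \<Gamma>" for u v
  proof -
    obtain h where h: "h \<in> carrier H" "u = Inl h \<or> u = Inr h" using uv by (auto simp: pverts_\<Gamma>)
    obtain h' where h': "h' \<in> carrier H" "v = Inl h' \<or> v = Inr h'" using uv by (auto simp: pverts_\<Gamma>)
    obtain f where f: "f \<in> N" "f (Inl h) = Inl h'" "f (Inr h) = Inr h'"
      using move[OF h(1) h'(1)] by blast
    let ?F = "compose (pverts \<Gamma>) s f"
    have F: "?F (Inl h) = Inr h'" "?F (Inr h) = Inl h'"
      using f s h h' by (auto simp: compose_def pverts_\<Gamma>)
    have "?F \<in> N" using s(1) f(1) by (rule N_compose)
    then show ?thesis using F f h(2) h'(2) by metis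
  qed
  then show ?thesis
    unfolding transitive_on_verts_def using N_subset_Aut by (meson subsetD)
qed

text \<open>
  The criterion separates tails from heads of arcs. For an arc \<open>x \<rightarrow> y\<close> there is a point \<open>z\<close> with at least \<open>s\<close>
  common neighbours with \<open>x\<close> that is not adjacent to \<open>y\<close>, while every point with at least \<open>s\<close> common
  neighbours with \<open>y\<close> is adjacent to \<open>x\<close>. Since \<open>E\<close> is symmetric and \<open>v0 = w0\<close>, arc-transitivity would
  provide an automorphism interchanging the roles of the points \<open>x\<close> and \<open>y\<close> without leaving the first half: it
  takes \<open>(h\<^sub>0, k\<^sub>1)\<close> over \<open>(x, y)\<close> to \<open>(k\<^sub>0, h\<^sub>1)\<close> over \<open>(y, x)\<close>.
\<close>

lemma half_arc_transitive_if:
  assumes w0: "w0 = v0" and E: "E = D \<union> D\<inverse>" and D: "transitive_on D"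
    and arc: "(x, y) \<in> D" and s: "0 < s"
    and out: "z \<in> (\<lambda>g. act g v0) ` carrier H"
      "s \<le> card {w. (x, w) \<in> E \<and> (z, w) \<in> E}" "(z, y) \<notin> E"
    and near_head: "\<And>z. z \<in> V \<Longrightarrow> s \<le> card {w. (y, w) \<in> E \<and> (z, w) \<in> E} \<Longrightarrow> (z, x) \<in> E"
  shows "half_arc_transitive \<Gamma>"
proof -
  have symE: "sym E" unfolding E by (rule sym_Un_converse)
  have pw: "pt w0 = pt v0" by (simp add: w0)
  have arcs: "(x, y) \<in> E" "(y, x) \<in> E" using arc E by auto
  obtain h where h: "h \<in> carrier H" "pt v0 h = x" using E_orbits[OF arcs(1)] pt_surj by metis
  obtain k where k: "k \<in> carrier H" "pt v0 k = y" using E_orbits[OF arcs(2)] pt_surj by metis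
  obtain l where l: "l \<in> carrier H" "pt v0 l = z" using out(1) pt_surj by (metis imageE)
  let ?m = "card {k \<in> carrier H. pt w0 k = w0}"
  have "\<one> \<in> {k \<in> carrier H. pt w0 k = w0}" using base_in by (simp add: pt_def act_one)
  then have m: "0 < ?m" using finite_group by (auto simp: card_gt_0_iff)
  have in_verts: "Inl h \<in> pverts \<Gamma>" "Inl l \<in> pverts \<Gamma>" "Inr k \<in> pverts \<Gamma>"
    using h k l by (auto simp: pverts_\<Gamma>)
  have "\<not> transitive_on_arcs (carrier (Aut \<Gamma>)) \<Gamma>"
  proof
    assume "transitive_on_arcs (carrier (Aut \<Gamma>)) \<Gamma>"
    moreover have "(Inl h, Inr k) \<in> parcs \<Gamma>" "(Inl k, Inr h) \<in> parcs \<Gamma>"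
      using h k arcs by (auto simp: arc_iff pw)
    ultimately obtain f where f: "f \<in> carrier (Aut \<Gamma>)"
        and "map_prod f f (Inl h, Inr k) = (Inl k, Inr h)"
      unfolding transitive_on_arcs_def by meson
    then have fhk: "f (Inl h) = Inl k" "f (Inr k) = Inr h" by auto
    have le: "s * ?m \<le> card (common_neighbours \<Gamma> (Inl k) (f (Inl l)))"
    proof -
      have "s * ?m \<le> card (common_neighbours \<Gamma> (Inl h) (Inl l))"
        using out(2) h l by (simp add: card_common_neighbours)
      also have "\<dots> \<le> card (common_neighbours \<Gamma> (f (Inl h)) (f (Inl l)))"
        by (rule card_common_neighbours_le[OF finite_pverts f in_verts(1,2)])
      finally show ?thesis by (simp add: fhk)
    qed
    moreover have "0 < s * ?m" using s m by simp
    ultimately have "0 < card (common_neighbours \<Gamma> (Inl k) (f (Inl l)))" by linarith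
    then have "common_neighbours \<Gamma> (Inl k) (f (Inl l)) \<noteq> {}" by auto
    then obtain w where "(Inl k, w) \<in> parcs \<Gamma>" "(f (Inl l), w) \<in> parcs \<Gamma>"
      by (auto simp: common_neighbours_def)
    \<comment> \<open>A vertex with a neighbour in common with \<open>k\<^sub>0\<close> lies in the first half.\<close>
    then obtain i where i: "f (Inl l) = Inl i" "i \<in> carrier H"
      by (cases w; cases "f (Inl l)") (auto simp: arc_iff)
    have "s \<le> card {w. (y, w) \<in> E \<and> (pt v0 i, w) \<in> E}"
      using le i k m by (simp add: card_common_neighbours)
    then have "(pt v0 i, x) \<in> E"
      using near_head i(2) base_in by (simp add: pt_closed)
    then have "(Inl i, Inr h) \<in> parcs \<Gamma>"
      using i h by (simp add: arc_iff pw)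
    then have "(Inl l, Inr k) \<in> parcs \<Gamma>"
      using Aut_arc_iff[OF f in_verts(2,3)] by (simp add: i fhk)
    then show False
      using out(3) k l by (simp add: arc_iff pw)
  qed
  then show ?thesis
    unfolding half_arc_transitive_def
    using vertex_transitive_if[OF w0 symE]
      edge_transitive_if_N[OF N_transitive_on_edges_if_orientation[OF w0 E D]] by blast
qed

end

section \<open>Symmetry groups on natural numbers\<close>

lemma finite_Aut:
  assumes "finite (pverts \<Delta>)"
  shows "finite (carrier (Aut \<Delta>))"
proof (rule finite_subset)
  show "carrier (Aut \<Delta>) \<subseteq> pverts \<Delta> \<rightarrow>\<^sub>E pverts \<Delta>"
  proof
    fix f assume "f \<in> carrier (Aut \<Delta>)"
    then have "f \<in> Bij (pverts \<Delta>)" by (simp add: Aut_def)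
    then show "f \<in> pverts \<Delta> \<rightarrow>\<^sub>E pverts \<Delta>"
      by (simp add: PiE_def Bij_imp_funcset Bij_imp_extensional)
  qed
  show "finite (pverts \<Delta> \<rightarrow>\<^sub>E pverts \<Delta>)" using assms by (intro finite_PiE)
qed

text \<open>
  The finite automorphism group is copied along an injection into the natural numbers, which then act
  by decoding.
\<close>

lemma nat_group_acting_as_Aut:
  assumes fin: "finite (pverts \<Delta>)"
  shows "\<exists>(H :: nat monoid) act. group_action H (pverts \<Delta>) act \<and> finite (carrier H)
           \<and> act ` carrier H = carrier (Aut \<Delta>)"
proof -
  let ?A = "Aut \<Delta>"
  interpret A: group ?A by (rule group_Aut)
  have finA: "finite (carrier ?A)" by (rule finite_Aut[OF fin])
  then obtain c :: "_ \<Rightarrow> nat" where c: "inj_on c (carrier ?A)"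
    using finite_imp_inj_to_nat_seg by metis
  define d where "d = inv_into (carrier ?A) c"
  have dc: "d (c f) = f" if "f \<in> carrier ?A" for f
    using c that by (simp add: d_def)
  define H :: "nat monoid" where
    "H = \<lparr>carrier = c ` carrier ?A, mult = (\<lambda>a b. c (d a \<otimes>\<^bsub>?A\<^esub> d b)), one = c \<one>\<^bsub>?A\<^esub>\<rparr>"
  have "c \<in> iso ?A H"
    using c by (auto simp: iso_def hom_def H_def dc bij_betw_def)
  from A.iso_imp_img_group[OF this] have grp: "group H" by (simp add: H_def)
  have d_hom: "d (a \<otimes>\<^bsub>H\<^esub> b) = d a \<otimes>\<^bsub>BijGroup (pverts \<Delta>)\<^esub> d b"
    if "a \<in> carrier H" "b \<in> carrier H" for a b
    using that by (auto simp: H_def dc) (simp add: Aut_def)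
  have img: "d ` carrier H = carrier ?A"
    by (force simp: H_def dc)
  then have "d a \<in> carrier (BijGroup (pverts \<Delta>))" if "a \<in> carrier H" for a
    using that subgroup.subset[OF subgroup_Aut] by blast
  then have "d \<in> hom H (BijGroup (pverts \<Delta>))"
    using d_hom by (auto simp: hom_def)
  then have "group_action H (pverts \<Delta>) d"
    using grp by (simp add: group_action_def group_hom_def group_hom_axioms_def group_BijGroup)
  moreover have "finite (carrier H)" using finA by (simp add: H_def)
  ultimately show ?thesis using img by blast
qed

text \<open>
  By finiteness an injection of the vertices that maps arcs to arcs permutes both the vertices and the arcs.
\<close>

lemma restrict_in_Aut:
  assumes V: "finite (pverts \<Delta>)" and D: "parcs \<Delta> \<subseteq> pverts \<Delta> \<times> pverts \<Delta>"
    and closed: "f ` pverts \<Delta> \<subseteq> pverts \<Delta>" and inj: "inj_on f (pverts \<Delta>)"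
    and arcs: "\<And>u v. (u, v) \<in> parcs \<Delta> \<Longrightarrow> (f u, f v) \<in> parcs \<Delta>"
  shows "restrict f (pverts \<Delta>) \<in> carrier (Aut \<Delta>)"
proof -
  have "f ` pverts \<Delta> = pverts \<Delta>" using V closed inj by (rule endo_inj_surj)
  moreover have "inj_on (restrict f (pverts \<Delta>)) (pverts \<Delta>)" using inj by (simp add: inj_on_def)
  ultimately have "restrict f (pverts \<Delta>) \<in> Bij (pverts \<Delta>)"
    by (simp add: Bij_def bij_betw_def)
  moreover have "(f u, f v) \<in> parcs \<Delta> \<longleftrightarrow> (u, v) \<in> parcs \<Delta>"
    if uv: "u \<in> pverts \<Delta>" "v \<in> pverts \<Delta>" for u v
  proof
    have "finite (parcs \<Delta>)" using V D finite_subset by blast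
    moreover have "map_prod f f ` parcs \<Delta> \<subseteq> parcs \<Delta>" using arcs by auto
    moreover have "inj_on (map_prod f f) (parcs \<Delta>)"
      using map_prod_inj_on[OF inj inj] D by (rule inj_on_subset)
    ultimately have "map_prod f f ` parcs \<Delta> = parcs \<Delta>" by (rule endo_inj_surj)
    moreover assume "(f u, f v) \<in> parcs \<Delta>"
    ultimately have "(f u, f v) \<in> map_prod f f ` parcs \<Delta>" by (simp only:)
    then obtain u' v' where u'v': "(u', v') \<in> parcs \<Delta>" "f u = f u'" "f v = f v'"
      by (elim imageE) auto
    have "u' \<in> pverts \<Delta>" "v' \<in> pverts \<Delta>" using u'v'(1) D by auto
    then have "u = u'" "v = v'" using uv u'v'(2,3) inj_onD[OF inj] by auto
    then show "(u, v) \<in> parcs \<Delta>" using u'v' by simp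
  qed (rule arcs)
  ultimately show ?thesis by (simp add: Aut_def)
qed


lemma nat_group_transitive_on_arcs:
  assumes fin: "finite (pverts \<Delta>)" and D: "parcs \<Delta> \<subseteq> pverts \<Delta> \<times> pverts \<Delta>"
    and trans: "\<And>x y x' y'. (x, y) \<in> parcs \<Delta> \<Longrightarrow> (x', y') \<in> parcs \<Delta> \<Longrightarrow>
                  \<exists>f\<in>carrier (Aut \<Delta>). f x = x' \<and> f y = y'"
  obtains H :: "nat monoid" and act where "group_action H (pverts \<Delta>) act" "finite (carrier H)"
    "\<forall>g\<in>carrier H. \<forall>x y. (x, y) \<in> parcs \<Delta> \<longrightarrow> (act g x, act g y) \<in> parcs \<Delta>"
    "\<forall>x y x' y'. (x, y) \<in> parcs \<Delta> \<longrightarrow> (x', y') \<in> parcs \<Delta> \<longrightarrow>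
       (\<exists>g\<in>carrier H. act g x = x' \<and> act g y = y')"
proof -
  obtain H :: "nat monoid" and act where act: "group_action H (pverts \<Delta>) act" "finite (carrier H)"
    and img: "act ` carrier H = carrier (Aut \<Delta>)"
    using nat_group_acting_as_Aut[OF fin] by blast
  have "(act g x, act g y) \<in> parcs \<Delta>" if "g \<in> carrier H" "(x, y) \<in> parcs \<Delta>" for g x y
  proof -
    have "act g \<in> carrier (Aut \<Delta>)" using img that(1) by blast
    moreover have "x \<in> pverts \<Delta>" "y \<in> pverts \<Delta>" using that(2) D by auto
    ultimately show ?thesis using that(2) by (simp add: Aut_arc_iff)
  qed
  moreover have "\<exists>g\<in>carrier H. act g x = x' \<and> act g y = y'"
    if "(x, y) \<in> parcs \<Delta>" "(x', y') \<in> parcs \<Delta>" for x y x' y'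
    using trans[OF that] unfolding img[symmetric] by auto
  ultimately show thesis by (intro that[OF act]) simp_all
qed

lemma card_carrier_ge:
  assumes "finite (carrier H)" "X \<subseteq> (\<lambda>g. act g v) ` carrier H"
  shows "card X \<le> card (carrier H)"
  using assms by (metis card_image_le card_mono finite_imageI le_trans)

section \<open>Points and pairs\<close>

lemma permutes_two_points:
  assumes "a \<in> X" "b \<in> X" "a \<noteq> b" "c \<in> X" "d \<in> X" "c \<noteq> d"
  shows "\<exists>\<sigma>. \<sigma> permutes X \<and> \<sigma> a = c \<and> \<sigma> b = d"
proof -
  define \<tau> where "\<tau> = transpose a c"
  have \<tau>: "\<tau> permutes X" unfolding \<tau>_def using assms by (intro permutes_swap_id)
  have \<tau>b: "\<tau> b \<in> X" "\<tau> b \<noteq> c" "\<tau> a = c"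
    using \<tau> assms by (auto simp: permutes_in_image \<tau>_def transpose_def)
  then have "transpose (\<tau> b) d permutes X" using assms by (intro permutes_swap_id)
  then have "transpose (\<tau> b) d \<circ> \<tau> permutes X" using \<tau> by (intro permutes_compose)
  moreover have "(transpose (\<tau> b) d \<circ> \<tau>) a = c" "(transpose (\<tau> b) d \<circ> \<tau>) b = d"
    using \<tau>b assms by (auto simp: transpose_def)
  ultimately show ?thesis by blast
qed

definition pairs :: "nat \<Rightarrow> nat set set" where
  "pairs n = {b. b \<subseteq> {..<n} \<and> card b = 2}"

lemma finite_pairs: "finite (pairs n)"
  by (rule finite_subset[of _ "Pow {..<n}"]) (auto simp: pairs_def)

lemma pair_in_pairs: "a < n \<Longrightarrow> c < n \<Longrightarrow> a \<noteq> c \<Longrightarrow> {a, c} \<in> pairs n"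
  by (auto simp: pairs_def)

lemma pairsE:
  assumes "b \<in> pairs n" "a \<in> b"
  obtains c where "b = {a, c}" "a \<noteq> c" "a < n" "c < n"
proof -
  obtain x y where "b = {x, y}" "x \<noteq> y" using assms by (auto simp: pairs_def card_2_iff)
  then show thesis using assms that[of x] that[of y] by (auto simp: pairs_def)
qed

lemma pairs_nonempty: "b \<in> pairs n \<Longrightarrow> \<exists>a. a \<in> b"
  by (auto simp: pairs_def card_2_iff)

lemma image_pairs: "\<sigma> permutes {..<n} \<Longrightarrow> b \<in> pairs n \<Longrightarrow> \<sigma> ` b \<in> pairs n"
  using permutes_image[of \<sigma> "{..<n}"]
  by (auto simp: pairs_def card_image[OF inj_on_subset[OF permutes_inj]])

lemma permutes_flag:
  assumes "b \<in> pairs n" "a \<in> b" "d \<in> pairs n" "c \<in> d"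
  shows "\<exists>\<sigma>. \<sigma> permutes {..<n} \<and> \<sigma> a = c \<and> \<sigma> ` b = d"
proof -
  obtain a' where a': "b = {a, a'}" "a \<noteq> a'" "a < n" "a' < n" using assms(1,2) by (rule pairsE)
  obtain c' where c': "d = {c, c'}" "c \<noteq> c'" "c < n" "c' < n" using assms(3,4) by (rule pairsE)
  obtain \<sigma> where "\<sigma> permutes {..<n}" "\<sigma> a = c" "\<sigma> a' = c'"
    using permutes_two_points[of a "{..<n}" a' c c'] a' c' by auto
  then show ?thesis using a' c' by auto
qed

lemma ex_pair_containing:
  assumes "2 \<le> n" "a < n" "c < n"
  shows "\<exists>b\<in>pairs n. a \<in> b \<and> c \<in> b"
proof (cases "a = c")
  case True
  define e where "e = (if a = 0 then 1 else 0 :: nat)"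
  have "e < n" "a \<noteq> e" using assms by (auto simp: e_def)
  then have "{a, e} \<in> pairs n" using assms by (intro pair_in_pairs)
  then show ?thesis using True by (intro bexI[where x = "{a, e}"]) simp_all
next
  case False
  then have "{a, c} \<in> pairs n" using assms by (intro pair_in_pairs)
  then show ?thesis by (intro bexI[where x = "{a, c}"]) simp_all
qed

lemma card_pairs: "2 * card (pairs n) = n * (n - 1)"
proof -
  have "card (pairs n) = n choose 2"
    using n_subsets[of "{..<n}" 2] by (simp add: pairs_def)
  moreover have "even (n * (n - 1))" by (cases n) auto
  ultimately show ?thesis by (simp add: choose_two)
qed

lemma card_pairs_containing:
  assumes "a < n"
  shows "card {b \<in> pairs n. a \<in> b} = n - 1"
proof -
  have "{b \<in> pairs n. a \<in> b} = (\<lambda>c. {a, c}) ` ({..<n} - {a})"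
    using assms by (auto elim!: pairsE intro!: pair_in_pairs)
  moreover have "inj_on (\<lambda>c. {a, c}) ({..<n} - {a})" by (auto simp: inj_on_def doubleton_eq_iff)
  ultimately show ?thesis using assms by (simp add: card_image)
qed

section \<open>An arc-transitive family\<close>

definition complete :: "nat \<Rightarrow> nat graph" where
  "complete n = \<lparr>pverts = {..<n}, parcs = {(i, j). i < n \<and> j < n \<and> i \<noteq> j}\<rparr>"

lemma arc_transitive_example:
  assumes n: "3 \<le> n"
  shows "\<exists>\<Gamma>\<in>(connected_net_bicayley_graphs :: (nat + nat) graph set).
           arc_transitive \<Gamma> \<and> n \<le> card (pverts \<Gamma>)"
proof -
  let ?D = "complete n"
  let ?E = "{(i, j). i < n \<and> j < n \<and> i \<noteq> j}"
  have V: "pverts ?D = {..<n}" and E: "parcs ?D = ?E" by (simp_all add: complete_def)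
  have autos: "\<exists>f\<in>carrier (Aut ?D). f i = i' \<and> f j = j'"
    if "(i, j) \<in> parcs ?D" "(i', j') \<in> parcs ?D" for i j i' j'
  proof -
    have ij: "(i, j) \<in> ?E" "(i', j') \<in> ?E" using that by (simp_all only: E)
    obtain \<sigma> where \<sigma>: "\<sigma> permutes {..<n}" "\<sigma> i = i'" "\<sigma> j = j'"
      using permutes_two_points[of i "{..<n}" j i' j'] ij by auto
    have "restrict \<sigma> (pverts ?D) \<in> carrier (Aut ?D)"
    proof (rule restrict_in_Aut)
      show "(\<sigma> u, \<sigma> v) \<in> parcs ?D" if "(u, v) \<in> parcs ?D" for u v
        using that permutes_in_image[OF \<sigma>(1)] permutes_inj[OF \<sigma>(1)] by (auto simp: E inj_eq)
      show "\<sigma> ` pverts ?D \<subseteq> pverts ?D" using permutes_image[OF \<sigma>(1)] by (simp add: V)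
      show "inj_on \<sigma> (pverts ?D)" using permutes_inj_on[OF \<sigma>(1)] .
    qed (auto simp: V E)
    moreover have "restrict \<sigma> (pverts ?D) i = i'" "restrict \<sigma> (pverts ?D) j = j'"
      using \<sigma> ij by (auto simp: V)
    ultimately show ?thesis by (intro bexI[where x = "restrict \<sigma> (pverts ?D)"]) simp_all
  qed
  have fin_D: "finite (pverts ?D)" "parcs ?D \<subseteq> pverts ?D \<times> pverts ?D" by (auto simp: V E)
  obtain H :: "nat monoid" and act where act: "group_action H (pverts ?D) act"
    and fin: "finite (carrier H)"
    and inv_D: "\<forall>g\<in>carrier H. \<forall>x y. (x, y) \<in> parcs ?D \<longrightarrow> (act g x, act g y) \<in> parcs ?D"
    and two_D: "\<forall>x y x' y'. (x, y) \<in> parcs ?D \<longrightarrow> (x', y') \<in> parcs ?D \<longrightarrow>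
                  (\<exists>g\<in>carrier H. act g x = x' \<and> act g y = y')"
    by (rule nat_group_transitive_on_arcs[OF fin_D]) (erule (1) autos, rule that)
  note act = act[unfolded V]
  have inv: "(act g x, act g y) \<in> ?E" if "g \<in> carrier H" "(x, y) \<in> ?E" for g x y
    using inv_D that by (simp only: E)
  have two: "\<exists>g\<in>carrier H. act g x = x' \<and> act g y = y'" if "(x, y) \<in> ?E" "(x', y') \<in> ?E" for x y x' y'
    using two_D that by (simp only: E)
  interpret A: group_action H "{..<n}" act by (rule act)
  have one: "\<exists>g\<in>carrier H. i = act g 0" if "i < n" for i
  proof -
    define j where "j = (if i = 0 then 1 else 0 :: nat)"
    have "(0, 1) \<in> ?E" "(i, j) \<in> ?E" using n that by (auto simp: j_def)
    from two[OF this] show ?thesis by metis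
  qed
  interpret O: orbital_bicayley H "{..<n}" act ?E 0 0
  proof unfold_locales
    show "(\<exists>g\<in>carrier H. x = act g 0) \<and> (\<exists>g\<in>carrier H. y = act g 0)" if "(x, y) \<in> ?E" for x y
      using that one by auto
  qed (use n fin inv in auto)
  have sym: "sym ?E" by (auto simp: sym_def)
  have trans: "O.transitive_on ?E" unfolding O.transitive_on_def using two by fast
  have "O.\<Gamma> \<in> connected_net_bicayley_graphs"
  proof (rule O.connected_net_if[OF O.N_transitive_on_edges_if_transitive[OF trans]])
    fix g g' assume g: "g \<in> carrier H" "g' \<in> carrier H"
    then have "act g 0 < n" "act g' 0 < n" using O.act_closed[of _ 0] n by auto
    moreover have "\<exists>y<n. i \<noteq> y \<and> j \<noteq> y" for i j :: nat
    proof -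
      consider "i \<noteq> 0" "j \<noteq> 0" | "i \<noteq> 1" "j \<noteq> 1" | "i \<noteq> 2" "j \<noteq> 2" by linarith
      then show ?thesis
        by cases (use n in \<open>auto intro: exI[where x = 0] exI[where x = 1] exI[where x = 2]\<close>)
    qed
    ultimately show "\<exists>y. (act g 0, y) \<in> ?E \<and> (act g' 0, y) \<in> ?E" by auto
  qed
  moreover have "arc_transitive O.\<Gamma>" using sym trans by (rule O.arc_transitive_if[OF refl])
  moreover have "n \<le> card (pverts O.\<Gamma>)"
  proof -
    have "{..<n} \<subseteq> (\<lambda>g. act g 0) ` carrier H" using one by auto
    then have "card {..<n} \<le> card (carrier H)" by (rule card_carrier_ge[OF fin])
    then show ?thesis unfolding O.card_pverts by simp
  qed
  ultimately show ?thesis by blast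
qed

section \<open>A semisymmetric family\<close>

definition point_pair_incidence :: "nat \<Rightarrow> nat set graph" where
  "point_pair_incidence n =
     \<lparr>pverts = {{a} | a. a < n} \<union> pairs n, parcs = {({a}, b) | a b. b \<in> pairs n \<and> a \<in> b}\<rparr>"

lemma semisymmetric_example:
  assumes n: "4 \<le> n"
  shows "\<exists>\<Gamma>\<in>(connected_net_bicayley_graphs :: (nat + nat) graph set).
           semisymmetric \<Gamma> \<and> n \<le> card (pverts \<Gamma>)"
proof -
  let ?D = "point_pair_incidence n"
  let ?V = "{{a} | a. a < n} \<union> pairs n"
  let ?E = "{({a}, b) | a b. b \<in> pairs n \<and> a \<in> b}"
  have V: "pverts ?D = ?V" and E: "parcs ?D = ?E" by (simp_all add: point_pair_incidence_def)
  have finV: "finite ?V" using finite_pairs by simp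
  have EV: "?E \<subseteq> ?V \<times> ?V" by (auto simp: pairs_def)
  have autos: "\<exists>f\<in>carrier (Aut ?D). f i = i' \<and> f j = j'"
    if "(i, j) \<in> parcs ?D" "(i', j') \<in> parcs ?D" for i j i' j'
  proof -
    have ij: "(i, j) \<in> ?E" "(i', j') \<in> ?E" using that by (simp_all only: E)
    obtain a a' where a: "i = {a}" "j \<in> pairs n" "a \<in> j" and a': "i' = {a'}" "j' \<in> pairs n" "a' \<in> j'"
      using ij by auto
    obtain \<sigma> where \<sigma>: "\<sigma> permutes {..<n}" "\<sigma> a = a'" "\<sigma> ` j = j'"
      using permutes_flag a a' by metis
    let ?f = "restrict ((`) \<sigma>) (pverts ?D)"
    have "?f \<in> carrier (Aut ?D)"
    proof (rule restrict_in_Aut)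
      show "(\<sigma> ` u, \<sigma> ` v) \<in> parcs ?D" if "(u, v) \<in> parcs ?D" for u v
        using that image_pairs[OF \<sigma>(1)] by (fastforce simp: E)
      show "(`) \<sigma> ` pverts ?D \<subseteq> pverts ?D"
        using image_pairs[OF \<sigma>(1)] permutes_in_image[OF \<sigma>(1)] by (auto simp: V)
      show "inj_on ((`) \<sigma>) (pverts ?D)"
        using permutes_inj[OF \<sigma>(1)] by (auto simp: inj_on_def inj_image_eq_iff)
    qed (use V E finV EV in auto)
    moreover have "i \<in> ?V" "j \<in> ?V" using ij EV by auto
    then have "?f i = i'" "?f j = j'" using \<sigma> a a' unfolding V by auto
    ultimately show ?thesis by (intro bexI[where x = ?f]) simp_all
  qed
  have fin_D: "finite (pverts ?D)" "parcs ?D \<subseteq> pverts ?D \<times> pverts ?D"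
    using finV EV by (simp_all only: V E)
  obtain H :: "nat monoid" and act where act: "group_action H (pverts ?D) act"
    and fin: "finite (carrier H)"
    and inv_D: "\<forall>g\<in>carrier H. \<forall>x y. (x, y) \<in> parcs ?D \<longrightarrow> (act g x, act g y) \<in> parcs ?D"
    and two_D: "\<forall>x y x' y'. (x, y) \<in> parcs ?D \<longrightarrow> (x', y') \<in> parcs ?D \<longrightarrow>
                  (\<exists>g\<in>carrier H. act g x = x' \<and> act g y = y')"
    by (rule nat_group_transitive_on_arcs[OF fin_D]) (erule (1) autos, rule that)
  note act = act[unfolded V]
  have inv: "(act g x, act g y) \<in> ?E" if "g \<in> carrier H" "(x, y) \<in> ?E" for g x y
    using inv_D that by (simp only: E)
  have two: "\<exists>g\<in>carrier H. act g x = x' \<and> act g y = y'" if "(x, y) \<in> ?E" "(x', y') \<in> ?E" for x y x' y'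
    using two_D that by (simp only: E)
  interpret A: group_action H ?V act by (rule act)
  have P: "{0, 1} \<in> pairs n" "{2, 3} \<in> pairs n" using n by (auto intro!: pair_in_pairs)
  then have base: "({0}, {0, 1}) \<in> ?E" "({2}, {2, 3}) \<in> ?E" by auto
  interpret O: orbital_bicayley H ?V act ?E "{0}" "{0, 1}"
  proof unfold_locales
    show "(\<exists>g\<in>carrier H. x = act g {0}) \<and> (\<exists>g\<in>carrier H. y = act g {0, 1})" if "(x, y) \<in> ?E" for x y
      using two[OF base(1) that] by blast
    show "{0} \<in> ?V" "{0, 1} \<in> ?V" using P(1) n by auto
  qed (use fin inv in blast)+
  have trans: "O.transitive_on ?E" unfolding O.transitive_on_def using two by blast
  have point: "\<exists>a<n. act g {0} = {a}" if "g \<in> carrier H" for g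
    using inv[OF that base(1)] by (auto simp: pairs_def)
  have common: "\<exists>y. (act g {0}, y) \<in> ?E \<and> (act g' {0}, y) \<in> ?E"
    if g: "g \<in> carrier H" "g' \<in> carrier H" for g g'
  proof -
    obtain a a' where "a < n" "act g {0} = {a}" "a' < n" "act g' {0} = {a'}"
      using point g by metis
    then show ?thesis using ex_pair_containing[of n a a'] n by auto
  qed
  obtain g where g: "g \<in> carrier H" "act g {0, 1} = {2, 3}" using two[OF base] by blast
  have "O.\<Gamma> \<in> connected_net_bicayley_graphs"
    by (rule O.connected_net_if[OF O.N_transitive_on_edges_if_transitive[OF trans] common])
  moreover have "semisymmetric O.\<Gamma>"
  proof (rule O.semisymmetric_if[OF trans common g(1)])
    show "\<not> ((x, {0, 1}) \<in> ?E \<and> (x, act g {0, 1}) \<in> ?E)" for x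
      unfolding g(2) by auto
  qed
  moreover have "n \<le> card (pverts O.\<Gamma>)"
  proof -
    have "(\<lambda>a. {a}) ` {..<n} \<subseteq> (\<lambda>g. act g {0}) ` carrier H"
    proof clarify
      fix a assume "a < n"
      then obtain b where "b \<in> pairs n" "a \<in> b" using ex_pair_containing[of n a a] n by auto
      then have "({a}, b) \<in> ?E" by blast
      from two[OF base(1) this] show "{a} \<in> (\<lambda>g. act g {0}) ` carrier H" by force
    qed
    then have "card ((\<lambda>a. {a}) ` {..<n}) \<le> card (carrier H)" by (rule card_carrier_ge[OF fin])
    then show ?thesis unfolding O.card_pverts by (simp add: card_image)
  qed
  ultimately show ?thesis by blast
qed

section \<open>A half-arc-transitive family\<close>

text \<open>
  Three is the least number of levels for which the links met by an arc are different: the link that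
  ends at its tail, the one along it, and the one that starts at its head.
\<close>

lemma level_cases: "(l :: 3) = k \<or> l = k + 1 \<or> l = k - 1"
proof -
  have "(m :: 3) = 0 \<or> m = 1 \<or> m = - 1" for m
  proof (cases m rule: bit1_cases)
    case (of_int z)
    then have "z = 0 \<or> z = 1 \<or> z = 2" by auto
    moreover have "(2 :: 3) = - 1" by simp
    ultimately show ?thesis using of_int(1) by auto
  qed
  from this[of "l - k"] show ?thesis by (auto simp: algebra_simps)
qed

lemma level_simps [simp]:
  "(l :: 3) + 1 \<noteq> l" "l \<noteq> l + 1" "l - 1 \<noteq> l" "l \<noteq> l - 1" "l - 1 \<noteq> l + 1" "l + 1 \<noteq> l - 1"
  "l + 1 + 1 = l - 1" "l - 1 - 1 = l + 1"
proof -
  have three: "(3 :: 3) = 0" by simp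
  show "l + 1 + 1 = l - 1" "l - 1 - 1 = l + 1"
    using three by (simp_all add: algebra_simps)
  have "l - 1 = l + 1 \<Longrightarrow> (2 :: 3) = 0" by (simp add: algebra_simps)
  moreover have "(2 :: 3) \<noteq> 0" by simp
  ultimately show "l - 1 \<noteq> l + 1" "l + 1 \<noteq> l - 1" by auto
qed auto

definition flag_chain_verts :: "nat \<Rightarrow> (3 \<times> nat \<times> nat set) set" where
  "flag_chain_verts n = UNIV \<times> {..<n} \<times> pairs n"

definition flag_chain_arcs :: "nat \<Rightarrow> (3 \<times> nat \<times> nat set) rel" where
  "flag_chain_arcs n = {((i, a, b), (j, a', b')). j = i + 1 \<and> a < n \<and> a' < n \<and> b \<in> pairs n \<and> b' \<in> pairs n \<and> a' \<in> b}"

definition flag_chain :: "nat \<Rightarrow> (3 \<times> nat \<times> nat set) graph" where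
  "flag_chain n = \<lparr>pverts = flag_chain_verts n, parcs = flag_chain_arcs n\<rparr>"

definition flag_chain_edges :: "nat \<Rightarrow> (3 \<times> nat \<times> nat set) rel" where
  "flag_chain_edges n = flag_chain_arcs n \<union> (flag_chain_arcs n)\<inverse>"

lemma flag_chain_edges_iff:
  "((i, a, b), (j, a', b')) \<in> flag_chain_edges n \<longleftrightarrow>
     a < n \<and> a' < n \<and> b \<in> pairs n \<and> b' \<in> pairs n \<and> (j = i + 1 \<and> a' \<in> b \<or> j = i - 1 \<and> a \<in> b')"
  by (auto simp: flag_chain_edges_def flag_chain_arcs_def)

lemma finite_flag_chain_verts: "finite (flag_chain_verts n)"
  by (simp add: flag_chain_verts_def finite_pairs)

lemma flag_chain_arcs_subset: "flag_chain_arcs n \<subseteq> flag_chain_verts n \<times> flag_chain_verts n"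
  by (auto simp: flag_chain_arcs_def flag_chain_verts_def)

text \<open>
  The pair \<open>b\<close> at level \<open>l\<close> and the point at level \<open>l + 1\<close> have to be moved by the same permutation \<open>s l\<close>; the
  three permutations are otherwise arbitrary. An arc from level \<open>i\<close> involves \<open>s (i - 1)\<close> by a
  point, \<open>s i\<close> by a flag and \<open>s (i + 1)\<close> by a pair, so each of them has only one task.
\<close>

lemma flag_chain_arc_transitive:
  assumes xy: "(x, y) \<in> flag_chain_arcs n" and xy': "(x', y') \<in> flag_chain_arcs n"
  shows "\<exists>f\<in>carrier (Aut (flag_chain n)). f x = x' \<and> f y = y'"
proof -
  obtain i a b a' b' where x: "x = (i, a, b)" and y: "y = (i + 1, a', b')" and
    ab: "a < n" "a' < n" "b \<in> pairs n" "b' \<in> pairs n" "a' \<in> b"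
    using xy by (auto simp: flag_chain_arcs_def)
  obtain j c d c' d' where x': "x' = (j, c, d)" and y': "y' = (j + 1, c', d')" and
    cd: "c < n" "c' < n" "d \<in> pairs n" "d' \<in> pairs n" "c' \<in> d"
    using xy' by (auto simp: flag_chain_arcs_def)
  obtain \<sigma>1 where \<sigma>1: "\<sigma>1 permutes {..<n}" "\<sigma>1 a = c"
    using ab cd permutes_swap_id[of a "{..<n}" c] by (metis lessThan_iff transpose_apply_first)
  obtain \<sigma>2 where \<sigma>2: "\<sigma>2 permutes {..<n}" "\<sigma>2 a' = c'" "\<sigma>2 ` b = d"
    using permutes_flag ab cd by metis
  obtain \<sigma>3 where \<sigma>3: "\<sigma>3 permutes {..<n}" "\<sigma>3 ` b' = d'"
    using permutes_flag ab(4) cd(4) pairs_nonempty by metis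
  define s where "s l = (if l = i then \<sigma>2 else if l = i + 1 then \<sigma>3 else \<sigma>1)" for l
  have s: "s l permutes {..<n}" for l using \<sigma>1 \<sigma>2 \<sigma>3 by (simp add: s_def)
  define f where "f = (\<lambda>(l, p, q). (l + (j - i), s (l - 1) p, s l ` q))"
  let ?F = "restrict f (pverts (flag_chain n))"
  have "?F \<in> carrier (Aut (flag_chain n))"
  proof (rule restrict_in_Aut)
    show "f ` pverts (flag_chain n) \<subseteq> pverts (flag_chain n)"
      using image_pairs[OF s] permutes_in_image[OF s]
      by (auto simp: f_def flag_chain_def flag_chain_verts_def)
    show "inj_on f (pverts (flag_chain n))"
    proof (rule inj_onI)
      fix u v assume uv: "f u = f v"
      obtain l p q where u: "u = (l, p, q)" by (cases u)
      obtain l' p' q' where v: "v = (l', p', q')" by (cases v)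
      have l: "l = l'" using uv by (simp add: f_def u v)
      have "p = p'" "q = q'"
        using uv[unfolded l] inj_eq[OF permutes_inj[OF s]] inj_image_eq_iff[OF permutes_inj[OF s]]
        by (simp_all add: f_def u v l)
      then show "u = v" by (simp add: u v l)
    qed
    show "(f u, f v) \<in> parcs (flag_chain n)" if "(u, v) \<in> parcs (flag_chain n)" for u v
      using that image_pairs[OF s] permutes_in_image[OF s]
      by (auto simp: f_def flag_chain_def flag_chain_arcs_def algebra_simps)
  qed (use finite_flag_chain_verts flag_chain_arcs_subset in \<open>auto simp: flag_chain_def\<close>)
  moreover have "x \<in> flag_chain_verts n" "y \<in> flag_chain_verts n"
    using xy flag_chain_arcs_subset by auto
  then have "?F x = x'" "?F y = y'"
    using \<sigma>1 \<sigma>2 \<sigma>3 by (auto simp: flag_chain_def f_def x y x' y' s_def)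
  ultimately show ?thesis by blast
qed

lemma flag_chain_ex_arc:
  assumes "x \<in> flag_chain_verts n"
  shows "\<exists>y. (x, y) \<in> flag_chain_arcs n"
proof -
  obtain i a b where x: "x = (i, a, b)" "a < n" "b \<in> pairs n"
    using assms by (auto simp: flag_chain_verts_def)
  then obtain a' where "a' \<in> b" using pairs_nonempty by blast
  then have "(x, (i + 1, a', b)) \<in> flag_chain_arcs n"
    using x by (auto simp: flag_chain_arcs_def pairs_def)
  then show ?thesis by blast
qed

lemma flag_chain_common_neighbour:
  assumes n: "2 \<le> n" and x: "x \<in> flag_chain_verts n" and z: "z \<in> flag_chain_verts n"
  shows "\<exists>w. (x, w) \<in> flag_chain_edges n \<and> (z, w) \<in> flag_chain_edges n"
proof -
  obtain i a b where x: "x = (i, a, b)" "a < n" "b \<in> pairs n"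
    using x by (auto simp: flag_chain_verts_def)
  obtain k c d where z: "z = (k, c, d)" "c < n" "d \<in> pairs n"
    using z by (auto simp: flag_chain_verts_def)
  obtain e where e: "e \<in> pairs n" "a \<in> e" "c \<in> e" using ex_pair_containing[OF n x(2) z(2)] by blast
  obtain p q where pq: "p \<in> b" "q \<in> d" using x z pairs_nonempty by metis
  then have "p < n" "q < n" using x z by (auto simp: pairs_def)
  consider "k = i" | "k = i + 1" | "k = i - 1" using level_cases by blast
  then show ?thesis
  proof cases
    case 1
    then show ?thesis
      using x z e n by (intro exI[of _ "(i - 1, 0, e)"]) (simp add: flag_chain_edges_iff)
  next
    case 2
    then show ?thesis
      using x z e pq \<open>q < n\<close> by (intro exI[of _ "(i - 1, q, e)"]) (simp add: flag_chain_edges_iff)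
  next
    case 3
    then show ?thesis
      using x z e pq \<open>p < n\<close> by (intro exI[of _ "(i + 1, p, e)"]) (simp add: flag_chain_edges_iff)
  qed
qed

text \<open>
  With \<open>\<beta>\<close> the number of pairs, vertices of one level whose points differ have at most \<open>2 \<beta>\<close> common
  out-neighbours and exactly \<open>n\<close> common in-neighbours (one pair contains both points), together less
  than \<open>\<beta> + n (n - 1) = 3 \<beta>\<close> when \<open>n < \<beta>\<close>, that is, when \<open>n \<ge> 4\<close>. Vertices of different
  levels have their common neighbours on the third level, and there are only \<open>2 (n - 1)\<close> of them.
\<close>

lemma card_flag_chain_common_less:
  assumes n: "4 \<le> n" and x: "(i, a, b) \<in> flag_chain_verts n" and z: "(k, c, d) \<in> flag_chain_verts n"
    and ne: "(k, c) \<noteq> (i, a)"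
  shows "card {w. ((i, a, b), w) \<in> flag_chain_edges n \<and> ((k, c, d), w) \<in> flag_chain_edges n}
       < card (pairs n) + n * (n - 1)" (is "card ?W < _")
proof -
  have x: "a < n" "b \<in> pairs n" and z: "c < n" "d \<in> pairs n"
    using assms by (auto simp: flag_chain_verts_def)
  have two: "2 * card (pairs n) = n * (n - 1)" by (rule card_pairs)
  have "n * 3 \<le> n * (n - 1)" using n by (intro mult_le_mono) auto
  then have big: "n < card (pairs n)" using two n by linarith
  have pair: "card e = 2" "finite e" if "e \<in> pairs n" for e
    using that by (auto simp: pairs_def finite_subset)
  have small: "2 * (n - 1) < card (pairs n) + n * (n - 1)"
    using big two n by linarith
  have rect: "card ({l} \<times> e \<times> {b' \<in> pairs n. p \<in> b'}) = 2 * (n - 1)" if "e \<in> pairs n" "p < n" for l :: 3 and e p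
    using that by (simp add: card_cartesian_product pair card_pairs_containing)
  have fin: "finite ({l} \<times> e \<times> {b' \<in> pairs n. p \<in> b'})" if "e \<in> pairs n" for l :: 3 and e p
    using that by (simp add: pair finite_pairs)
  consider (same) "k = i" "c \<noteq> a" | (up) "k = i + 1" | (down) "k = i - 1" using level_cases ne by blast
  then show ?thesis
  proof cases
    case same
    let ?O = "{i + 1} \<times> b \<times> pairs n" and ?I = "{i - 1} \<times> {..<n} \<times> {{a, c}}"
    have "?W \<subseteq> ?O \<union> ?I"
    proof
      fix w assume w: "w \<in> ?W"
      obtain l p q where w_eq: "w = (l, p, q)" by (cases w)
      have "q = {a, c}" if "q \<in> pairs n" "a \<in> q" "c \<in> q"
        using that same(2) by (auto elim!: pairsE)
      then show "w \<in> ?O \<union> ?I"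
        using w same(1) unfolding w_eq by (auto simp: flag_chain_edges_iff)
    qed
    then have "card ?W \<le> card (?O \<union> ?I)"
      using x by (intro card_mono) (auto simp: pair finite_pairs)
    also have "\<dots> \<le> card ?O + card ?I" by (rule card_Un_le)
    also have "\<dots> = 2 * card (pairs n) + n"
      using x by (simp add: card_cartesian_product pair)
    also have "\<dots> < card (pairs n) + n * (n - 1)" using big two by linarith
    finally show ?thesis .
  next
    case up
    have "?W \<subseteq> {i - 1} \<times> d \<times> {b' \<in> pairs n. a \<in> b'}"
      using up by (auto simp: flag_chain_edges_iff)
    then have "card ?W \<le> card ({i - 1} \<times> d \<times> {b' \<in> pairs n. a \<in> b'})"
      by (rule card_mono[OF fin[OF z(2)]])
    also have "\<dots> = 2 * (n - 1)" by (rule rect[OF z(2) x(1)])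
    finally show ?thesis using small by (rule le_less_trans)
  next
    case down
    have "?W \<subseteq> {i + 1} \<times> b \<times> {b' \<in> pairs n. c \<in> b'}"
      using down by (auto simp: flag_chain_edges_iff)
    then have "card ?W \<le> card ({i + 1} \<times> b \<times> {b' \<in> pairs n. c \<in> b'})"
      by (rule card_mono[OF fin[OF x(2)]])
    also have "\<dots> = 2 * (n - 1)" by (rule rect[OF x(2) z(1)])
    finally show ?thesis using small by (rule le_less_trans)
  qed
qed

text \<open>
  Vertices with equal points share all \<open>n (n - 1)\<close> in-neighbours; if their pairs meet, they also share the
  \<open>\<beta>\<close> out-neighbours over the common point. Together this reaches the number that vertices with
  different points cannot reach.
\<close>

lemma card_flag_chain_common_ge:
  assumes n: "3 \<le> n"
  shows "card (pairs n) + n * (n - 1)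
       \<le> card {w. ((0, 0, {0, 1}), w) \<in> flag_chain_edges n \<and> ((0, 0, {1, 2}), w) \<in> flag_chain_edges n}"
    (is "_ \<le> card ?W")
proof -
  let ?O = "{1 :: 3} \<times> {1 :: nat} \<times> pairs n" and ?I = "{- 1 :: 3} \<times> {..<n} \<times> {b \<in> pairs n. 0 \<in> b}"
  have "card ?O = card (pairs n)" "card ?I = n * (n - 1)"
    using n by (simp_all add: card_cartesian_product card_pairs_containing)
  moreover have "card (?O \<union> ?I) = card ?O + card ?I"
    by (rule card_Un_disjoint) (auto simp: finite_pairs)
  moreover have "card (?O \<union> ?I) \<le> card ?W"
  proof (rule card_mono)
    show "finite ?W"
      by (rule finite_subset[OF _ finite_flag_chain_verts[of n]])
        (use flag_chain_arcs_subset in \<open>auto simp: flag_chain_edges_def\<close>)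
    have "{0, 1} \<in> pairs n" "{1, 2} \<in> pairs n" using n by (auto intro!: pair_in_pairs)
    then show "?O \<union> ?I \<subseteq> ?W" using n by (auto simp: flag_chain_edges_iff)
  qed
  ultimately show ?thesis by linarith
qed

lemma half_arc_transitive_example:
  assumes n: "4 \<le> n"
  shows "\<exists>\<Gamma>\<in>(connected_net_bicayley_graphs :: (nat + nat) graph set).
           half_arc_transitive \<Gamma> \<and> n \<le> card (pverts \<Gamma>)"
proof -
  let ?G = "flag_chain n" and ?V = "flag_chain_verts n"
    and ?D = "flag_chain_arcs n" and ?E = "flag_chain_edges n"
  have V: "pverts ?G = ?V" and A: "parcs ?G = ?D" by (simp_all add: flag_chain_def)
  have fin_D: "finite (pverts ?G)" "parcs ?G \<subseteq> pverts ?G \<times> pverts ?G"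
    using finite_flag_chain_verts flag_chain_arcs_subset by (simp_all only: V A)
  have autos: "\<exists>f\<in>carrier (Aut ?G). f x = x' \<and> f y = y'"
    if "(x, y) \<in> parcs ?G" "(x', y') \<in> parcs ?G" for x y x' y'
    using flag_chain_arc_transitive that by (simp only: A)
  obtain H :: "nat monoid" and act where act: "group_action H (pverts ?G) act"
    and fin: "finite (carrier H)"
    and inv_D: "\<forall>g\<in>carrier H. \<forall>x y. (x, y) \<in> parcs ?G \<longrightarrow> (act g x, act g y) \<in> parcs ?G"
    and two_D: "\<forall>x y x' y'. (x, y) \<in> parcs ?G \<longrightarrow> (x', y') \<in> parcs ?G \<longrightarrow>
                  (\<exists>g\<in>carrier H. act g x = x' \<and> act g y = y')"
    by (rule nat_group_transitive_on_arcs[OF fin_D])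
      (erule (1) autos, rule that)
  note act = act[unfolded V]
  have inv: "(act g x, act g y) \<in> ?D" if "g \<in> carrier H" "(x, y) \<in> ?D" for g x y
    using inv_D that by (simp only: A)
  have two: "\<exists>g\<in>carrier H. act g x = x' \<and> act g y = y'" if "(x, y) \<in> ?D" "(x', y') \<in> ?D" for x y x' y'
    using two_D that by (simp only: A)
  interpret A: group_action H ?V act by (rule act)
  define v0 :: "3 \<times> nat \<times> nat set" where "v0 = (0, 0, {0, 1})"
  define v1 :: "3 \<times> nat \<times> nat set" where "v1 = (1, 0, {0, 1})"
  define z0 :: "3 \<times> nat \<times> nat set" where "z0 = (0, 0, {1, 2})"
  have P: "{0, 1} \<in> pairs n" "{1, 2} \<in> pairs n" using n by (auto intro!: pair_in_pairs)
  have verts: "v0 \<in> ?V" "v1 \<in> ?V" "z0 \<in> ?V"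
    using P n by (auto simp: v0_def v1_def z0_def flag_chain_verts_def)
  have arc: "(v0, v1) \<in> ?D"
    using P n by (auto simp: v0_def v1_def flag_chain_arcs_def)
  have one: "\<exists>g\<in>carrier H. x = act g v0" if x: "x \<in> ?V" for x
  proof -
    obtain y where "(x, y) \<in> ?D" using flag_chain_ex_arc[OF x] by blast
    from two[OF arc this] show ?thesis by metis
  qed
  have EV: "?E \<subseteq> ?V \<times> ?V" using flag_chain_arcs_subset by (auto simp: flag_chain_edges_def)
  interpret O: orbital_bicayley H ?V act ?E v0 v0
  proof unfold_locales
    show "(\<exists>g\<in>carrier H. x = act g v0) \<and> (\<exists>g\<in>carrier H. y = act g v0)" if "(x, y) \<in> ?E" for x y
      using that EV one by blast
    show "(act g x, act g y) \<in> ?E" if "g \<in> carrier H" "(x, y) \<in> ?E" for g x y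
      using that inv[OF that(1), of x y] inv[OF that(1), of y x]
      unfolding flag_chain_edges_def by blast
  qed (fact verts fin)+
  have trans: "O.transitive_on ?D" unfolding O.transitive_on_def using two by fast
  note E = flag_chain_edges_def[of n]
  \<comment> \<open>By the two counts, \<open>?s\<close> common neighbours force equal levels and points, hence equal in-neighbours.
     So \<open>v0\<close>, an in-neighbour of \<open>v1\<close>, is adjacent to each such \<open>z\<close>; but \<open>z0\<close>, which differs from \<open>v0\<close> in the
     pair, is not adjacent to the out-neighbour \<open>v1\<close> of \<open>v0\<close>.\<close>
  let ?s = "card (pairs n) + n * (n - 1)"
  have "O.\<Gamma> \<in> connected_net_bicayley_graphs"
  proof (rule O.connected_net_if[OF O.N_transitive_on_edges_if_orientation[OF refl E trans]])
    fix g g' assume "g \<in> carrier H" "g' \<in> carrier H"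
    then have "act g v0 \<in> ?V" "act g' v0 \<in> ?V" using verts(1) by (auto intro: O.act_closed)
    then show "\<exists>y. (act g v0, y) \<in> ?E \<and> (act g' v0, y) \<in> ?E"
      using n by (intro flag_chain_common_neighbour) auto
  qed
  moreover have "half_arc_transitive O.\<Gamma>"
  proof (rule O.half_arc_transitive_if[OF refl E trans arc, where s = ?s and z = z0])
    show "0 < ?s" using n by simp
    show "z0 \<in> (\<lambda>g. act g v0) ` carrier H" using one[OF verts(3)] by blast
    show "?s \<le> card {w. (v0, w) \<in> ?E \<and> (z0, w) \<in> ?E}"
      unfolding v0_def z0_def using n by (intro card_flag_chain_common_ge) simp
    show "(z0, v1) \<notin> ?E" by (auto simp: z0_def v1_def flag_chain_edges_iff)
    show "(z, v0) \<in> ?E" if z: "z \<in> ?V" "?s \<le> card {w. (v1, w) \<in> ?E \<and> (z, w) \<in> ?E}" for z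
    proof -
      obtain k c d where zeq: "z = (k, c, d)" by (cases z)
      have "(k, c) = (1, 0)"
        using card_flag_chain_common_less[OF n, of 1 0 "{0, 1}" k c d] verts(2) z
        unfolding v1_def zeq by fastforce
      then show ?thesis
        using z(1) P n by (auto simp: zeq v0_def flag_chain_edges_iff flag_chain_verts_def)
    qed
  qed
  moreover have "n \<le> card (pverts O.\<Gamma>)"
  proof -
    have "(\<lambda>a. (0, a, {0, 1})) ` {..<n} \<subseteq> (\<lambda>g. act g v0) ` carrier H"
      using one P by (force simp: flag_chain_verts_def)
    then have "card ((\<lambda>a. (0 :: 3, a, {0, 1 :: nat})) ` {..<n}) \<le> card (carrier H)"
      by (rule card_carrier_ge[OF fin])
    then show ?thesis unfolding O.card_pverts by (simp add: card_image inj_on_def)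
  qed
  ultimately show ?thesis by blast
qed

section \<open>The theorem\<close>

lemma infinite_iso_classes_net:
  assumes "\<And>n. 4 \<le> n \<Longrightarrow> \<exists>\<Gamma>\<in>(connected_net_bicayley_graphs :: (nat + nat) graph set).
                           P \<Gamma> \<and> n \<le> card (pverts \<Gamma>)"
  shows "infinite (iso_classes {\<Gamma> \<in> (connected_net_bicayley_graphs :: (nat + nat) graph set). P \<Gamma>})"
proof (rule infinite_iso_classes)
  fix n
  show "\<exists>\<Gamma>\<in>{\<Gamma> \<in> (connected_net_bicayley_graphs :: (nat + nat) graph set). P \<Gamma>}. n \<le> card (pverts \<Gamma>)"
    using assms[of "n + 4"] by force
next
  fix \<Gamma> assume "\<Gamma> \<in> {\<Gamma> \<in> (connected_net_bicayley_graphs :: (nat + nat) graph set). P \<Gamma>}"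
  then show "pair_graph \<Gamma>"
    by (auto simp: connected_net_bicayley_graphs_def intro: pair_graph_BiCay)
qed

theorem theorem1p2:
  shows "(\<forall>\<Gamma> \<in> (connected_net_bicayley_graphs :: ('a + 'a) graph set).
            arc_transitive \<Gamma> \<or> half_arc_transitive \<Gamma> \<or> semisymmetric \<Gamma>)
       \<and> infinite (iso_classes {\<Gamma> \<in> (connected_net_bicayley_graphs :: (nat + nat) graph set).
            arc_transitive \<Gamma>})
       \<and> infinite (iso_classes {\<Gamma> \<in> (connected_net_bicayley_graphs :: (nat + nat) graph set).
            half_arc_transitive \<Gamma>})
       \<and> infinite (iso_classes {\<Gamma> \<in> (connected_net_bicayley_graphs :: (nat + nat) graph set).
            semisymmetric \<Gamma>})"
  using infinite_iso_classes_net[OF arc_transitive_example]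
    infinite_iso_classes_net[OF half_arc_transitive_example]
    infinite_iso_classes_net[OF semisymmetric_example]
  by (intro conjI ballI connected_net_trichotomy) simp_all

end
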